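(* Let $\mathbf{T}>0$, let $F$ and $G$ be continuously differentiable matrix functions on $[0,\mathbf{T}]$ of sizes $r\times p$ and $p\times r$, respectively, with $F(x)G(x)=I_r$ for $0\le x\le\mathbf{T}$. Then the operator $K$ on $L^2_r(0,\mathbf{T})$ defined by $$(Kf)(x)=F(x)\int_0^xG(t)f(t)\,dt$$ is similar to the operator of integration $(Af)(x)=\int_0^xf(t)\,dt$ on $L^2_r(0,\mathbf{T})$. More precisely, $K=EAE^{-1}$, where $E$ is a lower triangular operator of the form $$(Ef)(x)=\rho(x)f(x)+\int_0^xe(x,t)f(t)\,dt,\qquad f\in L^2_r(0,\mathbf{T}).$$ Here $e(x,t)$ is a continuous $r\times r$ matrix function on $0\le t\le x\le\mathbf{T}$ which is zero at $t=0$, and the $r\times r$ matrix function $\rho$ is given by $$\frac{d}{dx}\rho(x)=F'(x)G(x)\rho(x),\qquad\rho(0)=I_r.$$ Moreover, the operators $E^{\pm1}$ map functions with a continuous derivative into functions with a continuous derivative.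
   Context: $L^2_r(0,\mathbf{T})$ is the Hilbert space of square integrable $\mathbb{C}^r$-valued functions on $(0,\mathbf{T})$. "Functions with a continuous derivative" are $\mathbb{C}^r$-valued continuously differentiable functions on $[0,\mathbf{T}]$. *)

theory Defs
  imports "HOL-Analysis.Analysis"
begin

text \<open>
  The space $L^2_r(0,T)$ is handled through representatives: its elements are the members of
  \<open>L2 T\<close>, and two of them are identified when \<open>ae_eq T\<close> holds.  The norm on \<open>complex^'r\<close> is the
  usual Hermitian one, so \<open>norm_L2\<close> is the Hilbert space norm.  Values outside \<open>(0,T)\<close> are
  irrelevant.
\<close>

definition L2 :: "real \<Rightarrow> (real \<Rightarrow> complex^'r) set" where
  "L2 T = {f. f \<in> borel_measurable (lebesgue_on {0<..<T}) \<and>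
              integrable (lebesgue_on {0<..<T}) (\<lambda>x. (norm (f x))\<^sup>2)}"

definition ae_eq :: "real \<Rightarrow> (real \<Rightarrow> complex^'r) \<Rightarrow> (real \<Rightarrow> complex^'r) \<Rightarrow> bool" where
  "ae_eq T f g \<longleftrightarrow> (AE x in lebesgue_on {0<..<T}. f x = g x)"

definition norm_L2 :: "real \<Rightarrow> (real \<Rightarrow> complex^'r) \<Rightarrow> real" where
  "norm_L2 T f = sqrt (LINT x|lebesgue_on {0<..<T}. (norm (f x))\<^sup>2)"

text \<open>
  Bounded complex-linear operators on $L^2_r(0,T)$.  The second clause says that \<open>S\<close> is well
  defined on classes modulo equality almost everywhere.
\<close>

definition bounded_op :: "real \<Rightarrow> ((real \<Rightarrow> complex^'r) \<Rightarrow> real \<Rightarrow> complex^'r) \<Rightarrow> bool" where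
  "bounded_op T S \<longleftrightarrow>
     (\<forall>f\<in>L2 T. S f \<in> L2 T) \<and>
     (\<forall>f\<in>L2 T. \<forall>g\<in>L2 T. ae_eq T f g \<longrightarrow> ae_eq T (S f) (S g)) \<and>
     (\<forall>f\<in>L2 T. \<forall>g\<in>L2 T. ae_eq T (S (\<lambda>x. f x + g x)) (\<lambda>x. S f x + S g x)) \<and>
     (\<forall>c. \<forall>f\<in>L2 T. ae_eq T (S (\<lambda>x. c *s f x)) (\<lambda>x. c *s S f x)) \<and>
     (\<exists>C. \<forall>f\<in>L2 T. norm_L2 T (S f) \<le> C * norm_L2 T f)"

definition inverse_ops :: "real \<Rightarrow> ((real \<Rightarrow> complex^'r) \<Rightarrow> real \<Rightarrow> complex^'r) \<Rightarrow>
    ((real \<Rightarrow> complex^'r) \<Rightarrow> real \<Rightarrow> complex^'r) \<Rightarrow> bool" where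
  "inverse_ops T S R \<longleftrightarrow> bounded_op T S \<and> bounded_op T R \<and>
     (\<forall>f\<in>L2 T. ae_eq T (S (R f)) f) \<and> (\<forall>f\<in>L2 T. ae_eq T (R (S f)) f)"

definition similar_op :: "real \<Rightarrow> ((real \<Rightarrow> complex^'r) \<Rightarrow> real \<Rightarrow> complex^'r) \<Rightarrow>
    ((real \<Rightarrow> complex^'r) \<Rightarrow> real \<Rightarrow> complex^'r) \<Rightarrow> bool" where
  "similar_op T K A \<longleftrightarrow> bounded_op T K \<and> bounded_op T A \<and>
     (\<exists>S R. inverse_ops T S R \<and> (\<forall>f\<in>L2 T. ae_eq T (K f) (S (A (R f)))))"

text \<open>
  One-sided derivatives at the end points; \<open>C1_differentiable_on\<close> is not suitable here, since it
  uses two-sided derivatives there.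
\<close>

definition C1_on_interval :: "real \<Rightarrow> (real \<Rightarrow> 'a::real_normed_vector) \<Rightarrow> bool" where
  "C1_on_interval T f \<longleftrightarrow>
     (\<exists>f'. (\<forall>x\<in>{0..T}. (f has_vector_derivative f' x) (at x within {0..T})) \<and>
           continuous_on {0..T} f')"

text \<open>
  An element of $L^2_r(0,T)$ counts as continuously differentiable when its class has such a
  representative, hence the \<open>ae_eq\<close> below.
\<close>

definition preserves_C1 :: "real \<Rightarrow> ((real \<Rightarrow> complex^'r) \<Rightarrow> real \<Rightarrow> complex^'r) \<Rightarrow> bool" where
  "preserves_C1 T S \<longleftrightarrow>
     (\<forall>f. C1_on_interval T f \<longrightarrow> (\<exists>g. C1_on_interval T g \<and> ae_eq T (S f) g))"

definition integration_op :: "(real \<Rightarrow> complex^'r) \<Rightarrow> real \<Rightarrow> complex^'r" where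
  "integration_op f = (\<lambda>x. LINT t:{0..x}|lebesgue. f t)"

definition K_op :: "(real \<Rightarrow> complex^'p^'r) \<Rightarrow> (real \<Rightarrow> complex^'r^'p) \<Rightarrow>
    (real \<Rightarrow> complex^'r) \<Rightarrow> real \<Rightarrow> complex^'r" where
  "K_op F G f = (\<lambda>x. F x *v (LINT t:{0..x}|lebesgue. G t *v f t))"

definition triangular_op :: "(real \<Rightarrow> complex^'r^'r) \<Rightarrow> (real \<Rightarrow> real \<Rightarrow> complex^'r^'r) \<Rightarrow>
    (real \<Rightarrow> complex^'r) \<Rightarrow> real \<Rightarrow> complex^'r" where
  "triangular_op \<rho> e f = (\<lambda>x. \<rho> x *v f x + (LINT t:{0..x}|lebesgue. e x t *v f t))"

end

theory Submission
  imports Defs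
begin

text \<open>
  $K$, $A$ and the operator $E$ sought are all operators \<open>triangular_op\<close>, so $KE = EA$ amounts to
  \[ F(x)\Bigl(G(t)\rho(t) + \int_t^x G(s)e(s,t)\,ds\Bigr) = \rho(x) + \int_t^x e(x,s)\,ds . \]
  The kernel comes from the canonical system $v' = zGFv$, $v(0) = G(0)$, since $E$ should send
  $e^{zx}$ to $Fv$. With $u = Fv$ and $w = v - Gu$ (so that $Fw = 0$) the system reads
  \[ u' = zu + F'Gu + F'w, \qquad w' = -(G' + GF'G)u - GF'w . \]
  The fundamental matrices $\rho' = F'G\rho$ and $\sigma' = -GF'\sigma$ remove the diagonal terms:
  for $u = \rho\tilde u$, $w = \sigma\tilde w$ one has $\tilde u' = z\tilde u + b\tilde w$ and
  $\tilde w' = c\tilde u$. The ansatz $\tilde u = e^{zx} + \int_0^x k(x,t)e^{zt}\,dt$,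
  $\tilde w = \int_0^x q(x,t)e^{zt}\,dt$ turns this into a Volterra system for $(k,q)$ on the
  triangle $0 \le t \le x \le T$, and $e(x,t) = \rho(x)k(x,t)$.

  Both $E$ and $E^{-1}$ preserve continuity, and $E1 = F(\cdot)G(0)$. Hence for $f$ continuously
  differentiable $Ef = F(\cdot)G(0)f(0) + KEf'$. Conversely $f - F(\cdot)G(0)f(0) = Kh$ has a
  continuous solution $h$ (differentiate to get a Volterra equation of the second kind), and then
  $E^{-1}f = f(0) + AE^{-1}h$.
\<close>

text \<open>Why exponentials: KE = EA together with E1 = F G(0) forces E to send (1 - zA)^{-1} 1 to
  (1 - zK)^{-1} F G(0). The former is e^{zx}; integrating the canonical system gives Fv = F G(0) +
  zK(Fv), so the latter is Fv. The exponentials only serve to find the kernels: the kernel identity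
  is then verified directly for each fixed t, without any completeness argument for exponentials.
  The obstacle is lack of smoothness. F' and G' are merely continuous, so k and q need not be
  differentiable and a partial differential equation for the kernel is out of reach. Their integrals
  over [t,x], however, are differentiable in x, and the computation is carried out with these. The
  constraint Fw = 0 is propagated from w = 0 at the start by F'G + FG' = 0. For L2 functions the
  composition and intertwining identities hold at every point of (0,T), which keeps null sets out of
  the kernel computations.\<close>

section \<open>Volterra equations and parameter integrals\<close>

text \<open>Banach's iteration in a weighted sup norm (Bielecki's method). With an exponential
  weight a Volterra map halves distances on the whole set, however long the interval, so one
  application gives a global solution. \<open>X\<close> stays abstract to cover both an interval and
  a triangle.\<close>

lemma weighted_contraction_fixpoint:
  fixes \<Phi> :: "('a::topological_space \<Rightarrow> 'b::banach) \<Rightarrow> 'a \<Rightarrow> 'b" and \<omega> :: "'a \<Rightarrow> real"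
  assumes X: "compact X" and \<omega>: "continuous_on X \<omega>" "\<And>p. p \<in> X \<Longrightarrow> 0 < \<omega> p"
    and cont: "\<And>g. continuous_on X g \<Longrightarrow> continuous_on X (\<Phi> g)"
    and contr: "\<And>g h D p. \<lbrakk>continuous_on X g; continuous_on X h; 0 \<le> D;
        \<And>p. p \<in> X \<Longrightarrow> norm (g p - h p) \<le> D * \<omega> p; p \<in> X\<rbrakk> \<Longrightarrow>
        norm (\<Phi> g p - \<Phi> h p) \<le> D / 2 * \<omega> p"
  obtains g where "continuous_on X g" "\<And>p. p \<in> X \<Longrightarrow> g p = \<Phi> g p"
proof (cases "X = {}")
  case True
  then show ?thesis using that[of "\<lambda>_. 0"] by simp
next
  case False
  define G where "G n = (\<Phi> ^^ n) (\<lambda>_. 0)" for n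
  have G_0: "G 0 = (\<lambda>_. 0)" and G_Suc: "G (Suc n) = \<Phi> (G n)" for n
    by (simp_all add: G_def)
  have cG: "continuous_on X (G n)" for n
    by (induction n) (auto simp: G_0 G_Suc cont)
  \<comment> \<open>The bounds \<open>m\<close> and \<Omega> on the weight make the weighted norm
    equivalent to the sup norm.\<close>
  obtain m where m: "0 < m" "\<And>p. p \<in> X \<Longrightarrow> m \<le> \<omega> p"
    using continuous_attains_inf[OF X False \<omega>(1)] \<omega>(2) by metis
  obtain \<Omega> where \<Omega>: "\<And>p. p \<in> X \<Longrightarrow> \<omega> p \<le> \<Omega>"
    using continuous_attains_sup[OF X False \<omega>(1)] by metis
  obtain q where "q \<in> X" using False by blast
  then have \<Omega>0: "0 < \<Omega>" using \<Omega>[of q] \<omega>(2)[of q] by linarith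
  obtain D where D: "0 \<le> D" "\<And>p. p \<in> X \<Longrightarrow> norm (G 1 p) \<le> D * \<omega> p"
  proof -
    have c1: "continuous_on X (\<lambda>p. norm (G 1 p))"
      by (intro continuous_intros cG)
    obtain B where B: "\<And>p. p \<in> X \<Longrightarrow> norm (G 1 p) \<le> B"
      using continuous_attains_sup[OF X False c1] by metis
    have B0: "0 \<le> B" using B[OF \<open>q \<in> X\<close>] norm_ge_zero order_trans by blast
    show ?thesis
    proof (rule that[of "B / m"])
      show "0 \<le> B / m" using B0 m(1) by simp
      fix p assume p: "p \<in> X"
      have "norm (G 1 p) \<le> B / m * m" using B[OF p] m(1) by simp
      also have "\<dots> \<le> B / m * \<omega> p"
        by (intro mult_left_mono m(2) p) (use B0 m(1) in simp)
      finally show "norm (G 1 p) \<le> B / m * \<omega> p" .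
    qed
  qed
  have step: "norm (G (Suc n) p - G n p) \<le> D / 2 ^ n * \<omega> p" if "p \<in> X" for n p
    using that
  proof (induction n arbitrary: p)
    case 0
    then show ?case using D by (simp add: G_0)
  next
    case (Suc n)
    show ?case
      using contr[OF cG cG _ Suc.IH Suc.prems] D(1) by (simp add: G_Suc mult.commute)
  qed
  define g where "g p = (\<Sum>i. G (Suc i) p - G i p)" for p
  have "uniform_limit X (\<lambda>n p. \<Sum>i<n. G (Suc i) p - G i p) g sequentially"
    unfolding g_def
  proof (rule Weierstrass_m_test)
    fix n p assume p: "p \<in> X"
    have "D / 2 ^ n * \<omega> p \<le> D / 2 ^ n * \<Omega>"
      by (intro mult_left_mono \<Omega> p) (use D(1) in simp)
    then show "norm (G (Suc n) p - G n p) \<le> D * \<Omega> * (1/2) ^ n"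
      using step[OF p, of n] by (simp add: power_divide algebra_simps)
  next
    show "summable (\<lambda>n. D * \<Omega> * (1/2::real) ^ n)"
      by (intro summable_mult summable_geometric) simp
  qed
  then have ul: "uniform_limit X G g sequentially"
    using sum_lessThan_telescope[of "\<lambda>i. G i p" for p] by (simp add: G_0)
  have cg: "continuous_on X g"
    by (rule uniform_limit_theorem[OF _ ul]) (use cG in auto)
  show ?thesis
  proof (rule that[OF cg])
    fix p assume p: "p \<in> X"
    have l1: "(\<lambda>n. G (Suc n) p) \<longlonglongrightarrow> g p"
      using tendsto_uniform_limitI[OF ul p] by (rule LIMSEQ_Suc)
    have l2: "(\<lambda>n. G (Suc n) p) \<longlonglongrightarrow> \<Phi> g p"
    proof (rule tendstoI)
      fix \<epsilon> :: real assume \<epsilon>: "0 < \<epsilon>"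
      \<comment> \<open>This sup distance corresponds to a weighted distance of at most
        \<epsilon>/\<Omega>. Applying \<open>\<Phi>\<close> halves it, and bounding the weight by
        \<Omega> then leaves at most \<epsilon>/2.\<close>
      have pos: "0 < \<epsilon> / \<Omega> * m" using \<epsilon> m \<Omega>0 by simp
      have "\<forall>\<^sub>F n in sequentially. \<forall>p\<in>X. dist (G n p) (g p) < \<epsilon> / \<Omega> * m"
        using uniform_limitD[OF ul pos] .
      then show "\<forall>\<^sub>F n in sequentially. dist (G (Suc n) p) (\<Phi> g p) < \<epsilon>"
      proof eventually_elim
        case (elim n)
        have "norm (\<Phi> (G n) p - \<Phi> g p) \<le> \<epsilon> / \<Omega> / 2 * \<omega> p"
        proof (rule contr[OF cG cg _ _ p])
          fix p assume p: "p \<in> X"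
          have "\<epsilon> / \<Omega> * m \<le> \<epsilon> / \<Omega> * \<omega> p"
            by (intro mult_left_mono m p) (use \<epsilon> \<Omega>0 in simp)
          then show "norm (G n p - g p) \<le> \<epsilon> / \<Omega> * \<omega> p"
            using elim p by (auto simp: dist_norm)
        qed (use \<epsilon> \<Omega>0 in simp)
        also have "\<dots> \<le> \<epsilon> / \<Omega> / 2 * \<Omega>"
          by (intro mult_left_mono \<Omega> p) (use \<epsilon> \<Omega>0 in simp)
        also have "\<dots> < \<epsilon>" using \<epsilon> \<Omega>0 by simp
        finally show ?case by (simp add: G_Suc dist_norm)
      qed
    qed
    show "g p = \<Phi> g p" using LIMSEQ_unique[OF l1 l2] .
  qed
qed

section \<open>Integrals with variable limits\<close>

lemma integral_affine_unit:
  fixes h :: "real \<Rightarrow> 'b::euclidean_space"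
  assumes "continuous_on {a..b} h" "a \<le> b"
  shows "integral {a..b} h = (b - a) *\<^sub>R integral {0..1} (\<lambda>u. h (a + u * (b - a)))"
proof (cases "a = b")
  case False
  then have ab: "a < b" using assms by simp
  have "(h has_integral integral {a..b} h) (cbox a b)"
    using assms(1) by (auto intro!: integrable_integral integrable_continuous_interval)
  from has_integral_affinity[OF this, of "b - a" a]
  have "((\<lambda>u. h ((b - a) * u + a)) has_integral (1 / (b - a)) *\<^sub>R integral {a..b} h)
      ((\<lambda>u. (u - a) / (b - a)) ` {a..b})"
    using ab by (simp add: divide_inverse_commute scaleR_diff_right algebra_simps)
  also have "(\<lambda>u. (u - a) / (b - a)) ` {a..b} = {0..1}"
  proof -
    have "u \<in> (\<lambda>u. (u - a) / (b - a)) ` {a..b}" if "0 \<le> u" "u \<le> 1" for u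
    proof (rule image_eqI)
      show "u = (a + u * (b - a) - a) / (b - a)" using ab by simp
      have "0 \<le> u * (b - a)" "u * (b - a) \<le> b - a"
        using that ab mult_left_le_one_le[of "b - a" u] by auto
      then show "a + u * (b - a) \<in> {a..b}"
        unfolding atLeastAtMost_iff by linarith
    qed
    then show ?thesis using ab by (auto simp: divide_simps)
  qed
  finally have "integral {0..1} (\<lambda>u. h ((b - a) * u + a)) = (1 / (b - a)) *\<^sub>R integral {a..b} h"
    by (rule integral_unique)
  then have "integral {0..1} (\<lambda>u. h (a + u * (b - a))) = (1 / (b - a)) *\<^sub>R integral {a..b} h"
    by (simp add: algebra_simps)
  then show ?thesis using ab by simp
qed simp

text \<open>Rescaling every segment to [0,1] by \<open>integral_affine_unit\<close> moves the limits
  into the integrand, and a parameter integral over a fixed interval remains. Continuity of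
  \<open>h\<close> is asked only above the segments, since kernels are controlled only on the
  triangle.\<close>

lemma continuous_on_integral_limits:
  fixes h :: "'a::topological_space \<Rightarrow> real \<Rightarrow> 'b::euclidean_space"
  assumes \<alpha>: "continuous_on X \<alpha>" and \<beta>: "continuous_on X \<beta>"
    and le: "\<And>p. p \<in> X \<Longrightarrow> \<alpha> p \<le> \<beta> p"
    and h: "continuous_on {(p, s). p \<in> X \<and> \<alpha> p \<le> s \<and> s \<le> \<beta> p} (\<lambda>(p, s). h p s)"
  shows "continuous_on X (\<lambda>p. integral {\<alpha> p..\<beta> p} (h p))"
proof -
  have sec: "continuous_on {\<alpha> p..\<beta> p} (h p)" if "p \<in> X" for p
    using continuous_on_compose2[OF h, of "{\<alpha> p..\<beta> p}" "\<lambda>s. (p, s)"] that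
    by (force intro!: continuous_intros)
  have fstc: "continuous_on (X \<times> {0..1::real}) (\<lambda>z. \<alpha> (fst z))"
    "continuous_on (X \<times> {0..1::real}) (\<lambda>z. \<beta> (fst z))"
    by (auto intro!: continuous_on_compose2[OF \<alpha>] continuous_on_compose2[OF \<beta>] continuous_intros)
  have in_seg: "\<alpha> p + u * (\<beta> p - \<alpha> p) \<le> \<beta> p" if "p \<in> X" "0 \<le> u" "u \<le> 1" for p u
    using mult_right_mono[of u 1 "\<beta> p - \<alpha> p"] that le[of p] by auto
  have "continuous_on (X \<times> {0..1::real})
      (\<lambda>z. (\<lambda>(p, s). h p s) (fst z, \<alpha> (fst z) + snd z * (\<beta> (fst z) - \<alpha> (fst z))))"
    by (rule continuous_on_compose2[OF h])
      (use in_seg le in \<open>auto intro!: continuous_intros fstc\<close>)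
  then have "continuous_on (X \<times> {0..1::real}) (\<lambda>(p, u). h p (\<alpha> p + u * (\<beta> p - \<alpha> p)))"
    by (simp add: case_prod_unfold)
  from integral_continuous_on_param[OF this[folded cbox_interval]]
  have "continuous_on X (\<lambda>p. (\<beta> p - \<alpha> p) *\<^sub>R integral {0..1} (\<lambda>u. h p (\<alpha> p + u * (\<beta> p - \<alpha> p))))"
    by (auto intro!: continuous_intros \<alpha> \<beta>)
  then show ?thesis
    by (rule continuous_on_cong[THEN iffD1, rotated -1])
      (auto simp: integral_affine_unit[OF sec le])
qed

text \<open>The factor 1/M is what makes Volterra maps contractive: integrating
  \<open>exp (M * s)\<close> from any starting point gives at most 1/M of its final value, whatever
  the length of the interval.\<close>

lemma norm_integral_le_exp:
  fixes h :: "real \<Rightarrow> 'b::euclidean_space"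
  assumes "continuous_on {a..x} h" "a \<le> x" "0 \<le> C" "0 < M"
    and "\<And>s. a \<le> s \<Longrightarrow> s \<le> x \<Longrightarrow> norm (h s) \<le> C * exp (M * s)"
  shows "norm (integral {a..x} h) \<le> C / M * exp (M * x)"
proof -
  have d: "((\<lambda>s. C / M * exp (M * s)) has_vector_derivative C * exp (M * s)) (at s within {a..x})" for s
    using \<open>0 < M\<close> by (auto intro!: derivative_eq_intros simp flip: has_real_derivative_iff_has_vector_derivative)
  have i: "((\<lambda>s. C * exp (M * s)) has_integral (C / M * exp (M * x) - C / M * exp (M * a))) {a..x}"
    by (rule fundamental_theorem_of_calculus[OF assms(2) d])
  have "norm (integral {a..x} h) \<le> integral {a..x} (\<lambda>s. C * exp (M * s))"
    by (rule integral_norm_bound_integral)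
      (use assms i in \<open>auto intro: integrable_continuous_interval\<close>)
  also have "\<dots> \<le> C / M * exp (M * x)"
    using integral_unique[OF i] assms(3,4) by simp
  finally show ?thesis .
qed

text \<open>Fubini for the integrand cut off by the indicator of the triangle. The cut-off function
  is integrable on the plane because the triangle is compact and \<open>h\<close> is continuous on
  it.\<close>

lemma integral_triangle_swap:
  fixes h :: "real \<Rightarrow> real \<Rightarrow> 'b::euclidean_space"
  assumes h: "continuous_on {(r, s). a \<le> s \<and> s \<le> r \<and> r \<le> b} (\<lambda>(r, s). h r s)"
  shows "integral {a..b} (\<lambda>r. integral {a..r} (\<lambda>s. h r s)) =
         integral {a..b} (\<lambda>s. integral {s..b} (\<lambda>r. h r s))"
proof -
  define S where "S = {(r, s). a \<le> s \<and> s \<le> r \<and> r \<le> b}"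
  have "closed S" unfolding S_def case_prod_unfold
    by (intro closed_Collect_conj closed_Collect_le continuous_intros)
  moreover have "bounded S"
    by (rule bounded_subset[of "cbox (a, a) (b, b)"]) (auto simp: S_def)
  ultimately have S: "compact S" by (simp add: compact_eq_bounded_closed)
  define k where "k r s = indicator S (r, s) *\<^sub>R h r s" for r s
  have "integrable lborel (\<lambda>z. indicator S z *\<^sub>R (\<lambda>(r, s). h r s) z)"
    using borel_integrable_compact[OF S h[folded S_def]] .
  then have "integrable (lborel \<Otimes>\<^sub>M lborel) (\<lambda>(r, s). k r s)"
    by (simp add: lborel_prod k_def case_prod_unfold)
  from lborel_pair.Fubini_integral[OF this]
  have F: "(LINT s|lborel. LINT r|lborel. k r s) = (LINT r|lborel. LINT s|lborel. k r s)" .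
  have c1: "continuous_on {a..b} (\<lambda>r. integral {a..r} (\<lambda>s. h r s))"
    by (rule continuous_on_integral_limits)
      (auto intro!: continuous_intros continuous_on_subset[OF h])
  have c2: "continuous_on {a..b} (\<lambda>s. integral {s..b} (\<lambda>r. h r s))"
  proof (rule continuous_on_integral_limits)
    show "continuous_on {(s, r). s \<in> {a..b} \<and> s \<le> r \<and> r \<le> b} (\<lambda>(s, r). h r s)"
      using continuous_on_compose2[OF h, of "{(s, r). s \<in> {a..b} \<and> s \<le> r \<and> r \<le> b}" "\<lambda>z. (snd z, fst z)"]
      by (force intro!: continuous_intros simp: case_prod_unfold)
  qed (auto intro!: continuous_intros)
  have cr: "continuous_on {a..r} (h r)" if "r \<in> {a..b}" for r
    using continuous_on_compose2[OF h, of "{a..r}" "\<lambda>s. (r, s)"] that by (force intro!: continuous_intros)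
  have cs: "continuous_on {s..b} (\<lambda>r. h r s)" if "s \<in> {a..b}" for s
    using continuous_on_compose2[OF h, of "{s..b}" "\<lambda>r. (r, s)"] that by (force intro!: continuous_intros)
  have LI: "(LINT x|lborel. indicator {u..v} x *\<^sub>R g x) = integral {u..v} g"
    if "continuous_on {u..v} g" for u v and g :: "real \<Rightarrow> 'b"
    using set_borel_integral_eq_integral(2)[OF borel_integrable_atLeastAtMost'[OF that]]
    by (simp add: set_lebesgue_integral_def)
  have k1: "(LINT s|lborel. k r s) = indicator {a..b} r *\<^sub>R integral {a..r} (h r)" for r
  proof (cases "r \<in> {a..b}")
    case True
    then have "k r s = indicator {a..r} s *\<^sub>R h r s" for s
      by (auto simp: k_def S_def indicator_def)
    then show ?thesis using LI[OF cr[OF True]] True by simp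
  next
    case False
    then have "k r s = 0" for s by (auto simp: k_def S_def indicator_def)
    then show ?thesis using False by simp
  qed
  have k2: "(LINT r|lborel. k r s) = indicator {a..b} s *\<^sub>R integral {s..b} (\<lambda>r. h r s)" for s
  proof (cases "s \<in> {a..b}")
    case True
    then have "k r s = indicator {s..b} r *\<^sub>R h r s" for r
      by (auto simp: k_def S_def indicator_def)
    then show ?thesis using LI[OF cs[OF True]] True by simp
  next
    case False
    then have "k r s = 0" for r by (auto simp: k_def S_def indicator_def)
    then show ?thesis using False by simp
  qed
  show ?thesis
    using F unfolding k1 k2 LI[OF c1] LI[OF c2] by simp
qed

section \<open>Matrix products as bounded bilinear maps\<close>

lemma bounded_bilinear_matrix_mult:
  "bounded_bilinear ((**) :: complex^'n^'m \<Rightarrow> complex^'k^'n \<Rightarrow> complex^'k^'m)"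
  unfolding bilinear_conv_bounded_bilinear[symmetric] bilinear_def
  by (auto intro!: linearI simp: vec_eq_iff matrix_matrix_mult_def
      sum.distrib scaleR_sum_right distrib_left distrib_right)

lemma bounded_bilinear_matrix_vector_mult:
  "bounded_bilinear ((*v) :: complex^'n^'m \<Rightarrow> complex^'n \<Rightarrow> complex^'m)"
  unfolding bilinear_conv_bounded_bilinear[symmetric] bilinear_def
  by (auto intro!: linearI simp: vec_eq_iff matrix_vector_mult_def
      sum.distrib scaleR_sum_right distrib_left distrib_right)

lemmas continuous_on_matrix_mult [continuous_intros] =
  bounded_bilinear.continuous_on[OF bounded_bilinear_matrix_mult]
lemmas continuous_on_matrix_vector_mult [continuous_intros] =
  bounded_bilinear.continuous_on[OF bounded_bilinear_matrix_vector_mult]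

section \<open>Triangular operators\<close>

definition triangle :: "real \<Rightarrow> (real \<times> real) set" where
  "triangle T = {(x, t). 0 \<le> t \<and> t \<le> x \<and> x \<le> T}"

text \<open>Extension by zero. Nothing is known about \<open>e\<close> off the triangle; for
  \<open>e\<close> continuous on the triangle the extension is bounded and Borel on the plane, and
  it absorbs the upper limit x, so that all integrals run over the fixed space (0,T).\<close>

definition tri_ext :: "real \<Rightarrow> (real \<Rightarrow> real \<Rightarrow> 'a::real_vector) \<Rightarrow> real \<Rightarrow> real \<Rightarrow> 'a" where
  "tri_ext T e x t = indicator (triangle T) (x, t) *\<^sub>R e x t"

lemma compact_triangle: "compact (triangle T)"
proof -
  have "closed (triangle T)" unfolding triangle_def case_prod_unfold
    by (intro closed_Collect_conj closed_Collect_le continuous_intros)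
  moreover have "bounded (triangle T)"
    by (rule bounded_subset[of "cbox (0, 0) (T, T)"]) (auto simp: triangle_def)
  ultimately show ?thesis by (simp add: compact_eq_bounded_closed)
qed

lemma tri_ext_bounded:
  fixes e :: "real \<Rightarrow> real \<Rightarrow> 'a::real_normed_vector"
  assumes "continuous_on (triangle T) (\<lambda>(x, t). e x t)"
  obtains C where "0 \<le> C" "\<And>x t. norm (tri_ext T e x t) \<le> C"
proof -
  have "bounded ((\<lambda>(x, t). e x t) ` triangle T)"
    by (intro compact_imp_bounded compact_continuous_image assms compact_triangle)
  then obtain B where "0 < B" "\<And>z. z \<in> triangle T \<Longrightarrow> norm ((\<lambda>(x, t). e x t) z) \<le> B"
    unfolding bounded_pos by blast
  then show ?thesis
    by (intro that[of B]) (auto simp: tri_ext_def indicator_def)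
qed

lemma bounded_on_interval:
  fixes f :: "real \<Rightarrow> 'a::real_normed_vector"
  assumes "continuous_on {a..b} f"
  obtains C where "0 \<le> C" "\<And>x. x \<in> {a..b} \<Longrightarrow> norm (f x) \<le> C"
proof -
  have "bounded (f ` {a..b})"
    by (intro compact_imp_bounded compact_continuous_image assms compact_Icc)
  then show ?thesis
    unfolding bounded_pos using that by (metis imageI less_imp_le)
qed

section \<open>Measurability of kernels and integrals over initial segments\<close>

lemma id_measurable_lebesgue_on [measurable]: "(\<lambda>x::real. x) \<in> borel_measurable (lebesgue_on S)"
  by (rule measurable_restrict_space1) (simp add: measurable_completion)

text \<open>Measurability is proved for the Borel sets of the plane and then pulled back along the
  pair map and its sections. The product of two spaces \<open>lebesgue_on\<close> is not the
  completed Lebesgue space of the plane, so Lebesgue measurability in the plane would not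
  suffice.\<close>

lemma tri_ext_measurable:
  fixes e :: "real \<Rightarrow> real \<Rightarrow> 'a::real_normed_vector"
  assumes "continuous_on (triangle T) (\<lambda>(x, t). e x t)"
  shows "(\<lambda>z. tri_ext T e (fst z) (snd z)) \<in> borel_measurable (lebesgue_on S \<Otimes>\<^sub>M lebesgue_on S')"
    and "tri_ext T e x \<in> borel_measurable (lebesgue_on S)"
    and "(\<lambda>x. tri_ext T e x t) \<in> borel_measurable (lebesgue_on S)"
proof -
  have "(\<lambda>z. indicator (triangle T) z *\<^sub>R (\<lambda>(x, t). e x t) z) \<in> borel_measurable borel"
    using compact_triangle[THEN compact_imp_closed]
    by (intro borel_measurable_continuous_on_indicator assms) auto
  also have "(\<lambda>z. indicator (triangle T) z *\<^sub>R (\<lambda>(x, t). e x t) z) = (\<lambda>z. tri_ext T e (fst z) (snd z))"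
    by (auto simp: tri_ext_def)
  finally have m: "(\<lambda>z. tri_ext T e (fst z) (snd z)) \<in> borel_measurable (borel \<Otimes>\<^sub>M borel)"
    by (simp add: borel_prod)
  have "(\<lambda>z. (fst z, snd z)) \<in> measurable (lebesgue_on S \<Otimes>\<^sub>M lebesgue_on S') (borel \<Otimes>\<^sub>M borel)"
    by measurable
  from measurable_compose[OF this m]
  show "(\<lambda>z. tri_ext T e (fst z) (snd z)) \<in> borel_measurable (lebesgue_on S \<Otimes>\<^sub>M lebesgue_on S')"
    by simp
  have "(\<lambda>t. (x, t)) \<in> measurable (lebesgue_on S) (borel \<Otimes>\<^sub>M borel)"
    by measurable
  from measurable_compose[OF this m]
  show "tri_ext T e x \<in> borel_measurable (lebesgue_on S)" by simp
  have "(\<lambda>x. (x, t)) \<in> measurable (lebesgue_on S) (borel \<Otimes>\<^sub>M borel)"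
    by measurable
  from measurable_compose[OF this m]
  show "(\<lambda>x. tri_ext T e x t) \<in> borel_measurable (lebesgue_on S)" by simp
qed

lemma borel_measurable_matrix_vector_mult [measurable (raw)]:
  fixes A :: "'a \<Rightarrow> complex^'n^'m" and f :: "'a \<Rightarrow> complex^'n"
  assumes "A \<in> borel_measurable M" "f \<in> borel_measurable M"
  shows "(\<lambda>x. A x *v f x) \<in> borel_measurable M"
  using assms by (rule borel_measurable_continuous_Pair) (intro continuous_intros)

lemma borel_measurable_matrix_mult [measurable (raw)]:
  fixes A :: "'a \<Rightarrow> complex^'n^'m" and B :: "'a \<Rightarrow> complex^'k^'n"
  assumes "A \<in> borel_measurable M" "B \<in> borel_measurable M"
  shows "(\<lambda>x. A x ** B x) \<in> borel_measurable M"
  using assms by (rule borel_measurable_continuous_Pair) (intro continuous_intros)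

lemma continuous_on_measurable_lebesgue_on:
  fixes f :: "real \<Rightarrow> 'a::euclidean_space"
  assumes "continuous_on {0..T} f"
  shows "f \<in> borel_measurable (lebesgue_on {0<..<T})"
  by (rule continuous_imp_measurable_on_sets_lebesgue)
    (auto intro: continuous_on_subset[OF assms])

lemma finite_measure_lebesgue_on_Ioo: "finite_measure (lebesgue_on {a<..<b::real})"
  by (intro finite_measure_lebesgue_on) simp

text \<open>Passes from the closed segment in the definition of the operators to the open interval
  on which L2 functions live. The two domains differ by the point 0, where \<open>h\<close> may have
  any value.\<close>

lemma LINT_initial_segment:
  fixes h :: "real \<Rightarrow> 'a::euclidean_space"
  assumes x: "0 < x" "x < T"
    and m: "(\<lambda>t. indicator {..x} t *\<^sub>R h t) \<in> borel_measurable (lebesgue_on {0<..<T})"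
  shows "(LINT t:{0..x}|lebesgue. h t) = (LINT t|lebesgue_on {0<..<T}. indicator {..x} t *\<^sub>R h t)"
proof -
  have m': "(\<lambda>t. indicator {0<..<T} t *\<^sub>R indicator {..x} t *\<^sub>R h t) \<in> borel_measurable lebesgue"
    using m by (subst (asm) borel_measurable_restrict_space_iff) auto
  have "(LINT t|lebesgue_on {0<..<T}. indicator {..x} t *\<^sub>R h t) =
      (LINT t|lebesgue. indicator {0<..<T} t *\<^sub>R indicator {..x} t *\<^sub>R h t)"
    by (rule integral_restrict_space) auto
  also have "\<dots> = (LINT t|lebesgue. indicator {0..x} t *\<^sub>R h t)"
  proof (rule integral_cong_AE[OF m'])
    \<comment> \<open>Adding the value at 0 by hand makes the integrand over \<open>{0..x}\<close>
      measurable, as the almost-everywhere comparison requires.\<close>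
    have "(\<lambda>t. indicator {0} t *\<^sub>R h 0) \<in> borel_measurable lebesgue"
      by (intro borel_measurable_scaleR borel_measurable_indicator) auto
    from borel_measurable_add[OF m' this]
    show "(\<lambda>t. indicator {0..x} t *\<^sub>R h t) \<in> borel_measurable lebesgue"
      by (rule measurable_cong[THEN iffD1, rotated]) (use x in \<open>auto simp: indicator_def\<close>)
    have "AE t in lebesgue. t \<noteq> 0"
      by (rule AE_I[of _ _ "{0}"]) auto
    then show "AE t in lebesgue. indicator {0<..<T} t *\<^sub>R indicator {..x} t *\<^sub>R h t = indicator {0..x} t *\<^sub>R h t"
      by eventually_elim (use x in \<open>auto simp: indicator_def\<close>)
  qed
  finally show ?thesis by (simp add: set_lebesgue_integral_def)
qed

lemma triangular_op_eq:
  fixes e :: "real \<Rightarrow> real \<Rightarrow> complex^'r^'r"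
  assumes x: "x \<in> {0<..<T}" and e: "continuous_on (triangle T) (\<lambda>(x, t). e x t)"
    and f: "f \<in> borel_measurable (lebesgue_on {0<..<T})"
  shows "triangular_op \<rho> e f x = \<rho> x *v f x + (LINT t|lebesgue_on {0<..<T}. tri_ext T e x t *v f t)"
proof -
  have eq: "indicator {..x} t *\<^sub>R (e x t *v f t) = tri_ext T e x t *v f t" if "t \<in> {0<..<T}" for t
    using x that by (auto simp: tri_ext_def triangle_def indicator_def)
  have "(\<lambda>t. tri_ext T e x t *v f t) \<in> borel_measurable (lebesgue_on {0<..<T})"
    using f tri_ext_measurable(2)[OF e] by measurable
  then have "(\<lambda>t. indicator {..x} t *\<^sub>R (e x t *v f t)) \<in> borel_measurable (lebesgue_on {0<..<T})"
    by (rule measurable_cong[THEN iffD1, rotated]) (simp add: eq)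
  from LINT_initial_segment[OF _ _ this] x
  have "(LINT t:{0..x}|lebesgue. e x t *v f t) =
      (LINT t|lebesgue_on {0<..<T}. indicator {..x} t *\<^sub>R (e x t *v f t))" by simp
  also have "\<dots> = (LINT t|lebesgue_on {0<..<T}. tri_ext T e x t *v f t)"
    by (intro Bochner_Integration.integral_cong) (simp_all add: eq)
  finally show ?thesis by (simp add: triangular_op_def)
qed

section \<open>L2 estimates and boundedness of triangular operators\<close>

lemma L2_D:
  assumes "f \<in> L2 T"
  shows "f \<in> borel_measurable (lebesgue_on {0<..<T})"
    and "integrable (lebesgue_on {0<..<T}) (\<lambda>x. (norm (f x))\<^sup>2)"
    and "integrable (lebesgue_on {0<..<T}) f"
    and "integrable (lebesgue_on {0<..<T}) (\<lambda>x. norm (f x))"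
proof -
  interpret finite_measure "lebesgue_on {0<..<T}" by (rule finite_measure_lebesgue_on_Ioo)
  show m: "f \<in> borel_measurable (lebesgue_on {0<..<T})"
    and i: "integrable (lebesgue_on {0<..<T}) (\<lambda>x. (norm (f x))\<^sup>2)"
    using assms by (auto simp: L2_def)
  \<comment> \<open>On a finite measure space this bound turns square integrability into
    integrability.\<close>
  have le: "y \<le> 1 + y\<^sup>2" if "0 \<le> y" for y :: real
    using zero_le_power2[of "y - 1"] that unfolding power2_diff by simp
  have "integrable (lebesgue_on {0<..<T}) (\<lambda>x. 1 + (norm (f x))\<^sup>2)"
    using i by simp
  then show "integrable (lebesgue_on {0<..<T}) f"
    by (rule Bochner_Integration.integrable_bound) (use m le in auto)
  then show "integrable (lebesgue_on {0<..<T}) (\<lambda>x. norm (f x))" by simp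
qed

lemma bounded_imp_L2:
  assumes "f \<in> borel_measurable (lebesgue_on {0<..<T})"
    and "\<And>x. x \<in> {0<..<T} \<Longrightarrow> norm (f x) \<le> C"
  shows "f \<in> L2 T"
proof -
  interpret finite_measure "lebesgue_on {0<..<T}" by (rule finite_measure_lebesgue_on_Ioo)
  have "integrable (lebesgue_on {0<..<T}) (\<lambda>x. (norm (f x))\<^sup>2)"
    by (rule integrable_const_bound[where B = "C\<^sup>2"])
      (use assms in \<open>auto intro!: AE_I2 power_mono\<close>)
  then show ?thesis using assms by (simp add: L2_def)
qed

lemma continuous_imp_L2:
  assumes "continuous_on {0..T} f"
  shows "f \<in> L2 T"
proof -
  obtain C where "\<And>x. x \<in> {0..T} \<Longrightarrow> norm (f x) \<le> C"
    using bounded_on_interval[OF assms] by metis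
  then show ?thesis
    by (intro bounded_imp_L2[of _ _ C] continuous_on_measurable_lebesgue_on assms) auto
qed

text \<open>Cauchy-Schwarz against the constant 1, obtained as nonnegativity of a variance:
  \<open>a\<close> below is the mean of |f| over an interval of length T.\<close>

lemma LINT_norm_le_norm_L2:
  assumes T: "0 < T" and f: "f \<in> L2 T"
  shows "(LINT x|lebesgue_on {0<..<T}. norm (f x)) \<le> sqrt T * norm_L2 T f"
proof -
  interpret finite_measure "lebesgue_on {0<..<T}" by (rule finite_measure_lebesgue_on_Ioo)
  define I where "I = (LINT x|lebesgue_on {0<..<T}. norm (f x))"
  define S where "S = (LINT x|lebesgue_on {0<..<T}. (norm (f x))\<^sup>2)"
  define a where "a = I / T"
  have meas: "measure (lebesgue_on {0<..<T}) {0<..<T} = T"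
    using T by (simp add: measure_restrict_space)
  have "0 \<le> (LINT x|lebesgue_on {0<..<T}. (norm (f x) - a)\<^sup>2)"
    by simp
  also have "\<dots> = (LINT x|lebesgue_on {0<..<T}. (norm (f x))\<^sup>2 + a\<^sup>2 - 2 * a * norm (f x))"
    by (simp add: power2_diff mult_ac)
  also have "\<dots> = S + a\<^sup>2 * T - 2 * a * I"
    using L2_D[OF f] meas by (simp add: S_def I_def mult.commute)
  also have "\<dots> = S - I\<^sup>2 / T"
    using T by (simp add: a_def power2_eq_square field_simps)
  finally have "I\<^sup>2 \<le> T * S" using T by (simp add: field_simps)
  then have "I \<le> sqrt (T * S)" by (rule real_le_rsqrt)
  then show ?thesis by (simp add: I_def S_def norm_L2_def real_sqrt_mult)
qed

lemma integrable_tri_ext: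
  fixes e :: "real \<Rightarrow> real \<Rightarrow> complex^'n^'m"
  assumes e: "continuous_on (triangle T) (\<lambda>(x, t). e x t)"
    and f: "integrable (lebesgue_on {0<..<T}) f"
  shows "integrable (lebesgue_on {0<..<T}) (\<lambda>t. tri_ext T e x t *v f t)"
proof -
  obtain C where C: "0 \<le> C" "\<And>x t. norm (tri_ext T e x t) \<le> C"
    using tri_ext_bounded[OF e] by metis
  obtain K where K: "0 \<le> K" "\<And>(A::complex^'n^'m) v. norm (A *v v) \<le> norm A * norm v * K"
    using bounded_bilinear.nonneg_bounded[OF bounded_bilinear_matrix_vector_mult] by metis
  have "norm (tri_ext T e x t *v f t) \<le> norm (C * K * norm (f t))" for t
  proof -
    have "norm (tri_ext T e x t *v f t) \<le> norm (tri_ext T e x t) * norm (f t) * K" by (rule K)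
    also have "\<dots> \<le> C * norm (f t) * K"
      by (intro mult_right_mono C K norm_ge_zero)
    finally show ?thesis using C K by (simp add: mult_ac)
  qed
  note bound = this
  show ?thesis
  proof (rule Bochner_Integration.integrable_bound[of _ "\<lambda>t. C * K * norm (f t)"])
    show "integrable (lebesgue_on {0<..<T}) (\<lambda>t. C * K * norm (f t))"
      using f by simp
    show "(\<lambda>t. tri_ext T e x t *v f t) \<in> borel_measurable (lebesgue_on {0<..<T})"
      using f by (intro borel_measurable_matrix_vector_mult tri_ext_measurable(2)[OF e] borel_measurable_integrable)
  qed (use bound in \<open>intro AE_I2\<close>)
qed

text \<open>The kernel is bounded, so the L1 norm of f controls the integral part. \<open>C\<close>
  is uniform in f and x; since (0,T) has finite measure, squaring and integrating will give the L2
  bound.\<close>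

lemma triangular_op_bound:
  fixes e :: "real \<Rightarrow> real \<Rightarrow> complex^'r^'r"
  assumes \<rho>: "continuous_on {0..T} \<rho>" and e: "continuous_on (triangle T) (\<lambda>(x, t). e x t)"
  obtains C where "0 \<le> C" "\<And>f x. \<lbrakk>f \<in> L2 T; x \<in> {0<..<T}\<rbrakk> \<Longrightarrow>
    norm (triangular_op \<rho> e f x) \<le> C * (norm (f x) + (LINT t|lebesgue_on {0<..<T}. norm (f t)))"
proof -
  obtain C where C: "0 \<le> C" "\<And>x t. norm (tri_ext T e x t) \<le> C"
    using tri_ext_bounded[OF e] by metis
  obtain R where R: "0 \<le> R" "\<And>x. x \<in> {0..T} \<Longrightarrow> norm (\<rho> x) \<le> R"
    using bounded_on_interval[OF \<rho>] by metis
  obtain K where K: "0 \<le> K" "\<And>(A::complex^'r^'r) v. norm (A *v v) \<le> norm A * norm v * K"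
    using bounded_bilinear.nonneg_bounded[OF bounded_bilinear_matrix_vector_mult] by metis
  show ?thesis
  proof (rule that[of "(R + C) * K"])
    fix f :: "real \<Rightarrow> complex^'r" and x assume f: "f \<in> L2 T" and x: "x \<in> {0<..<T}"
    have "norm (LINT t|lebesgue_on {0<..<T}. tri_ext T e x t *v f t)
        \<le> (LINT t|lebesgue_on {0<..<T}. norm (tri_ext T e x t *v f t))"
      by (rule integral_norm_bound)
    also have "\<dots> \<le> (LINT t|lebesgue_on {0<..<T}. C * K * norm (f t))"
    proof (rule integral_mono)
      fix t
      have "norm (tri_ext T e x t *v f t) \<le> norm (tri_ext T e x t) * norm (f t) * K" by (rule K)
      also have "\<dots> \<le> C * norm (f t) * K"
        by (intro mult_right_mono C K norm_ge_zero)
      finally show "norm (tri_ext T e x t *v f t) \<le> C * K * norm (f t)" by (simp add: mult_ac)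
    qed (use integrable_tri_ext[OF e] L2_D[OF f] in auto)
    finally have 1: "norm (LINT t|lebesgue_on {0<..<T}. tri_ext T e x t *v f t)
        \<le> C * K * (LINT t|lebesgue_on {0<..<T}. norm (f t))" by simp
    have "norm (\<rho> x *v f x) \<le> norm (\<rho> x) * norm (f x) * K" by (rule K)
    also have "\<dots> \<le> R * norm (f x) * K"
      by (intro mult_right_mono R K norm_ge_zero) (use x in simp)
    finally have 2: "norm (\<rho> x *v f x) \<le> R * K * norm (f x)" by (simp add: mult_ac)
    have "0 \<le> (LINT t|lebesgue_on {0<..<T}. norm (f t))" by simp
    then have 3: "0 \<le> R * K * (LINT t|lebesgue_on {0<..<T}. norm (f t))" "0 \<le> C * K * norm (f x)"
      using R C K by simp_all
    have "norm (triangular_op \<rho> e f x) \<le> R * K * norm (f x) + C * K * (LINT t|lebesgue_on {0<..<T}. norm (f t))"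
      unfolding triangular_op_eq[OF x e L2_D(1)[OF f]]
      by (rule norm_triangle_mono[OF 2 1])
    then show "norm (triangular_op \<rho> e f x) \<le> (R + C) * K * (norm (f x) + (LINT t|lebesgue_on {0<..<T}. norm (f t)))"
      using 3 by (simp add: algebra_simps)
  qed (use R C K in simp)
qed

lemma triangular_op_measurable:
  fixes e :: "real \<Rightarrow> real \<Rightarrow> complex^'r^'r"
  assumes \<rho>: "continuous_on {0..T} \<rho>" and e: "continuous_on (triangle T) (\<lambda>(x, t). e x t)"
    and f: "f \<in> L2 T"
  shows "triangular_op \<rho> e f \<in> borel_measurable (lebesgue_on {0<..<T})"
proof -
  interpret finite_measure "lebesgue_on {0<..<T}" by (rule finite_measure_lebesgue_on_Ioo)
  have fm [measurable]: "f \<in> borel_measurable (lebesgue_on {0<..<T})" using f by (rule L2_D)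
  have [measurable]: "\<rho> \<in> borel_measurable (lebesgue_on {0<..<T})"
    by (rule continuous_on_measurable_lebesgue_on[OF \<rho>])
  have "(\<lambda>z. tri_ext T e (fst z) (snd z) *v f (snd z))
      \<in> borel_measurable (lebesgue_on {0<..<T} \<Otimes>\<^sub>M lebesgue_on {0<..<T})"
    by (rule borel_measurable_matrix_vector_mult[OF tri_ext_measurable(1)[OF e]]) measurable
  then have "(\<lambda>x. LINT t|lebesgue_on {0<..<T}. tri_ext T e x t *v f t) \<in> borel_measurable (lebesgue_on {0<..<T})"
    by (intro borel_measurable_lebesgue_integral) (simp add: case_prod_unfold)
  then have "(\<lambda>x. \<rho> x *v f x + (LINT t|lebesgue_on {0<..<T}. tri_ext T e x t *v f t))
      \<in> borel_measurable (lebesgue_on {0<..<T})"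
    by measurable
  then show ?thesis
    by (rule measurable_cong[THEN iffD1, rotated]) (simp add: triangular_op_eq[OF _ e fm])
qed

lemma ae_eqI:
  assumes "\<And>x. x \<in> {0<..<T} \<Longrightarrow> f x = g x"
  shows "ae_eq T f g"
  unfolding ae_eq_def using assms by (intro AE_I2) auto

lemma bounded_op_triangular:
  fixes e :: "real \<Rightarrow> real \<Rightarrow> complex^'r^'r"
  assumes T: "0 < T" and \<rho>: "continuous_on {0..T} \<rho>"
    and e: "continuous_on (triangle T) (\<lambda>(x, t). e x t)"
  shows "bounded_op T (triangular_op \<rho> e)"
proof -
  interpret finite_measure "lebesgue_on {0<..<T}" by (rule finite_measure_lebesgue_on_Ioo)
  obtain C where C: "0 \<le> C" "\<And>f x. \<lbrakk>f \<in> L2 T; x \<in> {0<..<T}\<rbrakk> \<Longrightarrow>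
      norm (triangular_op \<rho> e f x) \<le> C * (norm (f x) + (LINT t|lebesgue_on {0<..<T}. norm (f t)))"
    using triangular_op_bound[OF \<rho> e] by metis
  have meas: "measure (lebesgue_on {0<..<T}) {0<..<T} = T"
    using T by (simp add: measure_restrict_space)
  \<comment> \<open>Squares the pointwise bound by (a + b)^2 <= 2a^2 + 2b^2 and replaces the L1 norm
    by the L2 norm at the cost of a factor T. Integration over (0,T) then produces the constant in
    \<open>bd\<close>.\<close>
  have ptw: "(norm (triangular_op \<rho> e f x))\<^sup>2 \<le> 2 * C\<^sup>2 * (norm (f x))\<^sup>2 + 2 * C\<^sup>2 * T * (norm_L2 T f)\<^sup>2"
    if f: "f \<in> L2 T" and x: "x \<in> {0<..<T}" for f x
  proof -
    define I where "I = (LINT t|lebesgue_on {0<..<T}. norm (f t))"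
    have I0: "0 \<le> I" by (simp add: I_def)
    have "I\<^sup>2 \<le> (sqrt T * norm_L2 T f)\<^sup>2"
      by (intro power_mono) (use LINT_norm_le_norm_L2[OF T f] I0 in \<open>auto simp: I_def\<close>)
    then have I2: "I\<^sup>2 \<le> T * (norm_L2 T f)\<^sup>2" using T by (simp add: power_mult_distrib)
    have "(norm (triangular_op \<rho> e f x))\<^sup>2 \<le> (C * (norm (f x) + I))\<^sup>2"
      by (intro power_mono) (use C(2)[OF f x] in \<open>auto simp: I_def\<close>)
    also have "\<dots> \<le> C\<^sup>2 * (2 * (norm (f x))\<^sup>2 + 2 * I\<^sup>2)"
      using zero_le_power2[of "norm (f x) - I"]
      by (auto simp: power_mult_distrib power2_diff power2_sum intro!: mult_left_mono)
    also have "\<dots> \<le> C\<^sup>2 * (2 * (norm (f x))\<^sup>2 + 2 * (T * (norm_L2 T f)\<^sup>2))"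
      by (intro mult_left_mono add_left_mono I2) auto
    finally show ?thesis by (simp add: algebra_simps)
  qed
  have L2: "triangular_op \<rho> e f \<in> L2 T" if f: "f \<in> L2 T" for f
  proof -
    have "integrable (lebesgue_on {0<..<T}) (\<lambda>x. 2 * C\<^sup>2 * (norm (f x))\<^sup>2 + 2 * C\<^sup>2 * T * (norm_L2 T f)\<^sup>2)"
      using L2_D(2)[OF f] by simp
    then have "integrable (lebesgue_on {0<..<T}) (\<lambda>x. (norm (triangular_op \<rho> e f x))\<^sup>2)"
      by (rule Bochner_Integration.integrable_bound)
        (use triangular_op_measurable[OF \<rho> e f] ptw[OF f] T in \<open>auto intro!: AE_I2\<close>)
    then show ?thesis using triangular_op_measurable[OF \<rho> e f] by (simp add: L2_def)
  qed
  have bd: "norm_L2 T (triangular_op \<rho> e f) \<le> sqrt (2 * C\<^sup>2 + 2 * C\<^sup>2 * T\<^sup>2) * norm_L2 T f"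
    if f: "f \<in> L2 T" for f
  proof -
    have n2: "(norm_L2 T g)\<^sup>2 = (LINT x|lebesgue_on {0<..<T}. (norm (g x))\<^sup>2)" for g :: "real \<Rightarrow> complex^'r"
      by (simp add: norm_L2_def)
    have "(LINT x|lebesgue_on {0<..<T}. (norm (triangular_op \<rho> e f x))\<^sup>2) \<le>
        (LINT x|lebesgue_on {0<..<T}. 2 * C\<^sup>2 * (norm (f x))\<^sup>2 + 2 * C\<^sup>2 * T * (norm_L2 T f)\<^sup>2)"
      by (rule integral_mono) (use L2_D(2)[OF f] L2_D(2)[OF L2[OF f]] ptw[OF f] in auto)
    also have "\<dots> = 2 * C\<^sup>2 * (norm_L2 T f)\<^sup>2 + 2 * C\<^sup>2 * T * (norm_L2 T f)\<^sup>2 * T"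
      using L2_D(2)[OF f] meas by (simp add: n2)
    also have "\<dots> = (2 * C\<^sup>2 + 2 * C\<^sup>2 * T\<^sup>2) * (norm_L2 T f)\<^sup>2"
      by (simp add: algebra_simps power2_eq_square)
    finally have "sqrt (LINT x|lebesgue_on {0<..<T}. (norm (triangular_op \<rho> e f x))\<^sup>2) \<le>
        sqrt ((2 * C\<^sup>2 + 2 * C\<^sup>2 * T\<^sup>2) * (norm_L2 T f)\<^sup>2)" by (rule real_sqrt_le_mono)
    then show ?thesis by (simp add: real_sqrt_mult norm_L2_def)
  qed
  have cong: "ae_eq T (triangular_op \<rho> e f) (triangular_op \<rho> e g)"
    if f: "f \<in> L2 T" and g: "g \<in> L2 T" and eq: "ae_eq T f g" for f g
  proof -
    \<comment> \<open>The integral parts agree at every x, so the two results can differ only where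
      f and g do.\<close>
    have i: "(LINT t|lebesgue_on {0<..<T}. tri_ext T e x t *v f t) = (LINT t|lebesgue_on {0<..<T}. tri_ext T e x t *v g t)" for x
      by (rule integral_cong_AE)
        (use eq integrable_tri_ext[OF e] L2_D(3)[OF f] L2_D(3)[OF g] in \<open>auto simp: ae_eq_def\<close>)
    have "AE x in lebesgue_on {0<..<T}. x \<in> {0<..<T} \<longrightarrow> triangular_op \<rho> e f x = triangular_op \<rho> e g x"
      using eq unfolding ae_eq_def
      by eventually_elim (simp add: i triangular_op_eq[OF _ e] L2_D(1)[OF f] L2_D(1)[OF g])
    then show ?thesis unfolding ae_eq_def by (simp add: AE_restrict_space_iff)
  qed
  have add: "ae_eq T (triangular_op \<rho> e (\<lambda>x. f x + g x)) (\<lambda>x. triangular_op \<rho> e f x + triangular_op \<rho> e g x)"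
    if f: "f \<in> L2 T" and g: "g \<in> L2 T" for f g
    using L2_D(1,3)[OF f] L2_D(1,3)[OF g] integrable_tri_ext[OF e]
    by (intro ae_eqI) (simp add: triangular_op_eq[OF _ e] matrix_vector_right_distrib)
  have scale: "ae_eq T (triangular_op \<rho> e (\<lambda>x. c *s f x)) (\<lambda>x. c *s triangular_op \<rho> e f x)"
    if f: "f \<in> L2 T" for c f
  proof (rule ae_eqI)
    fix x assume x: "x \<in> {0<..<T}"
    have bl: "bounded_linear (\<lambda>v::complex^'r. c *s v)"
      unfolding linear_conv_bounded_linear[symmetric]
      by (auto intro!: linearI simp: vec_eq_iff distrib_left)
    have "(\<lambda>x. c *s f x) \<in> borel_measurable (lebesgue_on {0<..<T})"
      using L2_D(3)[OF f] by (intro borel_measurable_integrable integrable_bounded_linear[OF bl])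
    then show "triangular_op \<rho> e (\<lambda>x. c *s f x) x = c *s triangular_op \<rho> e f x"
      using integral_bounded_linear[OF bl integrable_tri_ext[OF e L2_D(3)[OF f]], of x]
      by (simp add: triangular_op_eq[OF x e] L2_D(1)[OF f] vector_scalar_commute vector_add_ldistrib)
  qed
  show ?thesis
    unfolding bounded_op_def using L2 bd cong add scale by blast
qed

section \<open>Composition of triangular operators\<close>

text \<open>The kernel of a product of two triangular operators (\<open>triangular_op_comp\<close>):
  the cross terms with the multiplication parts, and the Volterra composition of the kernels.
  Inversion and intertwining thereby become questions about kernels.\<close>

definition comp_kernel :: "(real \<Rightarrow> complex^'r^'r) \<Rightarrow> (real \<Rightarrow> real \<Rightarrow> complex^'r^'r) \<Rightarrow>
    (real \<Rightarrow> complex^'r^'r) \<Rightarrow> (real \<Rightarrow> real \<Rightarrow> complex^'r^'r) \<Rightarrow> real \<Rightarrow> real \<Rightarrow> complex^'r^'r" where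
  "comp_kernel \<rho>\<^sub>1 e\<^sub>1 \<rho>\<^sub>2 e\<^sub>2 x t =
     \<rho>\<^sub>1 x ** e\<^sub>2 x t + e\<^sub>1 x t ** \<rho>\<^sub>2 t + integral {t..x} (\<lambda>s. e\<^sub>1 x s ** e\<^sub>2 s t)"

lemma continuous_on_triangle_compose:
  assumes e: "continuous_on (triangle T) (\<lambda>(x, t). e x t)"
    and "continuous_on S f" "continuous_on S g"
    and "\<And>p. p \<in> S \<Longrightarrow> 0 \<le> g p \<and> g p \<le> f p \<and> f p \<le> T"
  shows "continuous_on S (\<lambda>p. e (f p) (g p))"
proof -
  have "continuous_on S (\<lambda>p. (\<lambda>(x, t). e x t) (f p, g p))"
    by (rule continuous_on_compose2[OF e]) (use assms in \<open>auto intro!: continuous_intros simp: triangle_def\<close>)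
  then show ?thesis by simp
qed

lemma LINT_eq_integral:
  fixes h :: "real \<Rightarrow> 'a::euclidean_space"
  assumes "continuous_on {a..b} h"
  shows "(LINT t:{a..b}|lebesgue. h t) = integral {a..b} h"
  using set_lebesgue_integral_eq_integral(2)[OF absolutely_integrable_continuous_real[OF assms]] .

text \<open>For continuous arguments the operator can be computed with the gauge integral on the
  closed interval, both ends included, as continuity and C1 statements require.\<close>

lemma triangular_op_continuous:
  assumes "continuous_on (triangle T) (\<lambda>(x, t). e x t)" "continuous_on {0..T} f" "x \<in> {0..T}"
  shows "triangular_op \<rho> e f x = \<rho> x *v f x + integral {0..x} (\<lambda>t. e x t *v f t)"
  unfolding triangular_op_def
  by (subst LINT_eq_integral)
    (use assms in \<open>auto intro!: continuous_intros continuous_on_triangle_compose[OF assms(1)]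
       intro: continuous_on_subset\<close>)

lemma continuous_on_triangular_op:
  assumes \<rho>: "continuous_on {0..T} \<rho>" and e: "continuous_on (triangle T) (\<lambda>(x, t). e x t)"
    and f: "continuous_on {0..T} f"
  shows "continuous_on {0..T} (triangular_op \<rho> e f)"
proof -
  have "continuous_on {0..T} (\<lambda>x. integral {0..x} (\<lambda>t. e x t *v f t))"
    by (rule continuous_on_integral_limits)
      (auto intro!: continuous_intros continuous_on_triangle_compose[OF e]
        continuous_on_compose2[OF f] simp: case_prod_unfold)
  then have "continuous_on {0..T} (\<lambda>x. \<rho> x *v f x + integral {0..x} (\<lambda>t. e x t *v f t))"
    by (intro continuous_intros \<rho> f)
  then show ?thesis
    by (rule continuous_on_cong[THEN iffD1, rotated -1]) (auto simp: triangular_op_continuous[OF e f])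
qed

lemma continuous_on_kernel_integral:
  fixes e\<^sub>1 :: "real \<Rightarrow> real \<Rightarrow> complex^'n^'m" and e\<^sub>2 :: "real \<Rightarrow> real \<Rightarrow> complex^'k^'n"
  assumes e1: "continuous_on (triangle T) (\<lambda>(x, t). e\<^sub>1 x t)"
    and e2: "continuous_on (triangle T) (\<lambda>(x, t). e\<^sub>2 x t)"
  shows "continuous_on (triangle T) (\<lambda>(x, t). integral {t..x} (\<lambda>s. e\<^sub>1 x s ** e\<^sub>2 s t))"
  unfolding case_prod_unfold
  by (rule continuous_on_integral_limits)
    (auto intro!: continuous_intros continuous_on_triangle_compose[OF e1]
      continuous_on_triangle_compose[OF e2] simp: case_prod_unfold triangle_def)

lemma continuous_on_comp_kernel:
  assumes \<rho>1: "continuous_on {0..T} \<rho>\<^sub>1" and e1: "continuous_on (triangle T) (\<lambda>(x, t). e\<^sub>1 x t)"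
    and \<rho>2: "continuous_on {0..T} \<rho>\<^sub>2" and e2: "continuous_on (triangle T) (\<lambda>(x, t). e\<^sub>2 x t)"
  shows "continuous_on (triangle T) (\<lambda>(x, t). comp_kernel \<rho>\<^sub>1 e\<^sub>1 \<rho>\<^sub>2 e\<^sub>2 x t)"
  using continuous_on_kernel_integral[OF e1 e2] e1 e2
  unfolding comp_kernel_def case_prod_unfold
  by (intro continuous_intros continuous_on_compose2[OF \<rho>1] continuous_on_compose2[OF \<rho>2])
    (auto simp: triangle_def)

text \<open>The supports of the two extended kernels confine s to [t,x]. For t > x nothing remains,
  which matches the zero extension on the right.\<close>

lemma LINT_tri_ext_mult:
  fixes e\<^sub>1 :: "real \<Rightarrow> real \<Rightarrow> complex^'n^'m" and e\<^sub>2 :: "real \<Rightarrow> real \<Rightarrow> complex^'k^'n"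
  assumes e1: "continuous_on (triangle T) (\<lambda>(x, t). e\<^sub>1 x t)"
    and e2: "continuous_on (triangle T) (\<lambda>(x, t). e\<^sub>2 x t)"
    and x: "x \<in> {0<..<T}" and t: "t \<in> {0<..<T}"
  shows "(LINT s|lebesgue_on {0<..<T}. tri_ext T e\<^sub>1 x s ** tri_ext T e\<^sub>2 s t) =
    tri_ext T (\<lambda>x t. integral {t..x} (\<lambda>s. e\<^sub>1 x s ** e\<^sub>2 s t)) x t"
proof (cases "t \<le> x")
  case True
  have c: "continuous_on {t..x} (\<lambda>s. e\<^sub>1 x s ** e\<^sub>2 s t)"
    by (intro continuous_intros continuous_on_triangle_compose[OF e1]
      continuous_on_triangle_compose[OF e2]) (use x t in auto)
  have "(LINT s|lebesgue_on {0<..<T}. tri_ext T e\<^sub>1 x s ** tri_ext T e\<^sub>2 s t) =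
      (LINT s|lebesgue. indicator {0<..<T} s *\<^sub>R (tri_ext T e\<^sub>1 x s ** tri_ext T e\<^sub>2 s t))"
    by (rule integral_restrict_space) auto
  also have "\<dots> = (LINT s:{t..x}|lebesgue. e\<^sub>1 x s ** e\<^sub>2 s t)"
    unfolding set_lebesgue_integral_def
    by (rule Bochner_Integration.integral_cong)
      (use x t True in \<open>auto simp: tri_ext_def triangle_def indicator_def
        bounded_bilinear.zero_left[OF bounded_bilinear_matrix_mult]
        bounded_bilinear.zero_right[OF bounded_bilinear_matrix_mult]\<close>)
  also have "\<dots> = integral {t..x} (\<lambda>s. e\<^sub>1 x s ** e\<^sub>2 s t)" by (rule LINT_eq_integral[OF c])
  finally show ?thesis using x t True by (simp add: tri_ext_def triangle_def)
next
  case False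
  then have "tri_ext T e\<^sub>1 x s ** tri_ext T e\<^sub>2 s t = 0" for s
    by (auto simp: tri_ext_def triangle_def indicator_def
        bounded_bilinear.zero_left[OF bounded_bilinear_matrix_mult]
        bounded_bilinear.zero_right[OF bounded_bilinear_matrix_mult])
  then show ?thesis using False by (simp add: tri_ext_def triangle_def)
qed

text \<open>Fubini on the square over (0,T). The double integrand is dominated by a constant times
  |f(t)|, which is integrable on the product because the measure is finite.\<close>

lemma LINT_tri_ext_swap:
  fixes e\<^sub>1 e\<^sub>2 :: "real \<Rightarrow> real \<Rightarrow> complex^'r^'r"
  assumes e1: "continuous_on (triangle T) (\<lambda>(x, t). e\<^sub>1 x t)"
    and e2: "continuous_on (triangle T) (\<lambda>(x, t). e\<^sub>2 x t)"
    and f: "f \<in> L2 T" and x: "x \<in> {0<..<T}"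
  shows "(LINT s|lebesgue_on {0<..<T}. tri_ext T e\<^sub>1 x s *v (LINT t|lebesgue_on {0<..<T}. tri_ext T e\<^sub>2 s t *v f t)) =
    (LINT t|lebesgue_on {0<..<T}. tri_ext T (\<lambda>x t. integral {t..x} (\<lambda>s. e\<^sub>1 x s ** e\<^sub>2 s t)) x t *v f t)"
proof -
  let ?M = "lebesgue_on {0<..<T}"
  interpret finite_measure ?M by (rule finite_measure_lebesgue_on_Ioo)
  interpret pair: pair_sigma_finite ?M ?M ..
  note fm = L2_D(1)[OF f] and fi = L2_D(3)[OF f] and fn = L2_D(4)[OF f]
  obtain C1 where C1: "0 \<le> C1" "\<And>x t. norm (tri_ext T e\<^sub>1 x t) \<le> C1"
    using tri_ext_bounded[OF e1] by metis
  obtain C2 where C2: "0 \<le> C2" "\<And>x t. norm (tri_ext T e\<^sub>2 x t) \<le> C2"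
    using tri_ext_bounded[OF e2] by metis
  obtain K where K: "0 \<le> K" "\<And>(A::complex^'r^'r) v. norm (A *v v) \<le> norm A * norm v * K"
    using bounded_bilinear.nonneg_bounded[OF bounded_bilinear_matrix_vector_mult] by metis
  define g where "g s t = tri_ext T e\<^sub>1 x s *v (tri_ext T e\<^sub>2 s t *v f t)" for s t
  have g_le: "norm (g s t) \<le> C1 * C2 * K * K * norm (f t)" for s t
  proof -
    have "norm (g s t) \<le> norm (tri_ext T e\<^sub>1 x s) * norm (tri_ext T e\<^sub>2 s t *v f t) * K"
      unfolding g_def by (rule K)
    also have "\<dots> \<le> C1 * (C2 * norm (f t) * K) * K"
    proof (intro mult_right_mono mult_mono C1 K)
      show "norm (tri_ext T e\<^sub>2 s t *v f t) \<le> C2 * norm (f t) * K"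
        by (rule order_trans[OF K(2)]) (intro mult_right_mono C2 K norm_ge_zero)
    qed simp
    finally show ?thesis by (simp add: mult_ac)
  qed
  have gm: "(\<lambda>(s, t). g s t) \<in> borel_measurable (?M \<Otimes>\<^sub>M ?M)"
  proof -
    have "(\<lambda>z. tri_ext T e\<^sub>1 x (fst z)) \<in> borel_measurable (?M \<Otimes>\<^sub>M ?M)"
      "(\<lambda>z. f (snd z)) \<in> borel_measurable (?M \<Otimes>\<^sub>M ?M)"
      using tri_ext_measurable(2)[OF e1] fm by measurable
    then show ?thesis
      unfolding g_def case_prod_unfold
      by (intro borel_measurable_matrix_vector_mult tri_ext_measurable(1)[OF e2])
  qed
  have bl: "bounded_linear (\<lambda>v. A *v v)" for A :: "complex^'r^'r"
    by (rule bounded_bilinear.bounded_linear_right[OF bounded_bilinear_matrix_vector_mult])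
  have gi: "integrable ?M (g s)" for s
    unfolding g_def by (intro integrable_bounded_linear[OF bl] integrable_tri_ext[OF e2 fi])
  have "integrable (?M \<Otimes>\<^sub>M ?M) (\<lambda>(s, t). g s t)"
  proof (rule pair.Fubini_integrable[OF gm])
    have "norm (LINT t|?M. norm (g s t)) \<le> C1 * C2 * K * K * (LINT t|?M. norm (f t))" for s
    proof -
      have "(LINT t|?M. norm (g s t)) \<le> (LINT t|?M. C1 * C2 * K * K * norm (f t))"
        by (rule integral_mono) (use gi fn g_le in auto)
      then show ?thesis by simp
    qed
    then show "integrable ?M (\<lambda>s. LINT t|?M. norm ((\<lambda>(s, t). g s t) (s, t)))"
      by (intro integrable_const_bound[where B = "C1 * C2 * K * K * (LINT t|?M. norm (f t))"] AE_I2)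
        (use gm in \<open>auto intro!: borel_measurable_lebesgue_integral simp: case_prod_unfold\<close>)
    show "AE s in ?M. integrable ?M (\<lambda>t. (\<lambda>(s, t). g s t) (s, t))" using gi by simp
  qed
  from pair.Fubini_integral[OF this]
  have swap: "(LINT s|?M. LINT t|?M. g s t) = (LINT t|?M. LINT s|?M. g s t)" by simp
  have ei: "integrable ?M (\<lambda>s. tri_ext T e\<^sub>1 x s ** tri_ext T e\<^sub>2 s t)" for t
  proof -
    obtain L where L: "0 \<le> L" "\<And>(A::complex^'r^'r) (B::complex^'r^'r). norm (A ** B) \<le> norm A * norm B * L"
      using bounded_bilinear.nonneg_bounded[OF bounded_bilinear_matrix_mult] by metis
    show ?thesis
    proof (rule integrable_const_bound[where B = "C1 * C2 * L"])
      show "AE s in ?M. norm (tri_ext T e\<^sub>1 x s ** tri_ext T e\<^sub>2 s t) \<le> C1 * C2 * L"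
        by (intro AE_I2 order_trans[OF L(2)] mult_right_mono mult_mono C1 C2 L) auto
    qed (intro borel_measurable_matrix_mult tri_ext_measurable(2)[OF e1] tri_ext_measurable(3)[OF e2])
  qed
  have "(LINT s|?M. tri_ext T e\<^sub>1 x s *v (LINT t|?M. tri_ext T e\<^sub>2 s t *v f t)) = (LINT s|?M. LINT t|?M. g s t)"
    unfolding g_def
    by (intro Bochner_Integration.integral_cong refl integral_bounded_linear[OF bl, symmetric]
        integrable_tri_ext[OF e2 fi])
  also have "\<dots> = (LINT t|?M. (LINT s|?M. tri_ext T e\<^sub>1 x s ** tri_ext T e\<^sub>2 s t) *v f t)"
    unfolding swap
  proof (intro Bochner_Integration.integral_cong refl)
    fix t
    have "bounded_linear (\<lambda>A :: complex^'r^'r. A *v f t)"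
      by (rule bounded_bilinear.bounded_linear_left[OF bounded_bilinear_matrix_vector_mult])
    from integral_bounded_linear[OF this ei]
    show "(LINT s|?M. g s t) = (LINT s|?M. tri_ext T e\<^sub>1 x s ** tri_ext T e\<^sub>2 s t) *v f t"
      by (simp add: g_def matrix_vector_mul_assoc)
  qed
  also have "\<dots> = (LINT t|?M. tri_ext T (\<lambda>x t. integral {t..x} (\<lambda>s. e\<^sub>1 x s ** e\<^sub>2 s t)) x t *v f t)"
    by (intro Bochner_Integration.integral_cong refl) (simp add: LINT_tri_ext_mult[OF e1 e2 x])
  finally show ?thesis .
qed

text \<open>Kernels are bounded and f is integrable, so every integral converges at each x. Hence
  the identity holds everywhere on (0,T) and not just almost everywhere.\<close>

lemma triangular_op_comp:
  fixes e\<^sub>1 e\<^sub>2 :: "real \<Rightarrow> real \<Rightarrow> complex^'r^'r"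
  assumes T: "0 < T"
    and \<rho>1: "continuous_on {0..T} \<rho>\<^sub>1" and e1: "continuous_on (triangle T) (\<lambda>(x, t). e\<^sub>1 x t)"
    and \<rho>2: "continuous_on {0..T} \<rho>\<^sub>2" and e2: "continuous_on (triangle T) (\<lambda>(x, t). e\<^sub>2 x t)"
    and f: "f \<in> L2 T" and x: "x \<in> {0<..<T}"
  shows "triangular_op \<rho>\<^sub>1 e\<^sub>1 (triangular_op \<rho>\<^sub>2 e\<^sub>2 f) x =
    triangular_op (\<lambda>x. \<rho>\<^sub>1 x ** \<rho>\<^sub>2 x) (comp_kernel \<rho>\<^sub>1 e\<^sub>1 \<rho>\<^sub>2 e\<^sub>2) f x"
proof -
  let ?M = "lebesgue_on {0<..<T}"
  let ?k = "\<lambda>x t. integral {t..x} (\<lambda>s. e\<^sub>1 x s ** e\<^sub>2 s t)"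
  note fm = L2_D(1)[OF f] and fi = L2_D(3)[OF f]
  have g: "triangular_op \<rho>\<^sub>2 e\<^sub>2 f \<in> L2 T"
    using bounded_op_triangular[OF T \<rho>2 e2] f by (auto simp: bounded_op_def)
  have \<rho>f: "integrable ?M (\<lambda>t. \<rho>\<^sub>2 t *v f t)"
  proof -
    \<comment> \<open>Multiplication by \<open>\<rho>\<^sub>2\<close> is the triangular operator
      with zero kernel, so its boundedness yields the integrability sought.\<close>
    have z: "continuous_on (triangle T) (\<lambda>(x, t). (0 :: complex^'r^'r))" by (simp add: case_prod_unfold)
    have "triangular_op \<rho>\<^sub>2 (\<lambda>_ _. 0) f \<in> L2 T"
      using bounded_op_triangular[OF T \<rho>2 z] f by (auto simp: bounded_op_def)
    from L2_D(3)[OF this] show ?thesis by (simp add: triangular_op_def)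
  qed
  have I2: "integrable ?M (\<lambda>s. LINT t|?M. tri_ext T e\<^sub>2 s t *v f t)"
  proof -
    have "integrable ?M (\<lambda>s. triangular_op \<rho>\<^sub>2 e\<^sub>2 f s - \<rho>\<^sub>2 s *v f s)"
      by (intro Bochner_Integration.integrable_diff L2_D(3)[OF g] \<rho>f)
    then show ?thesis
      by (rule Bochner_Integration.integrable_cong[THEN iffD1, OF refl, rotated])
        (simp add: triangular_op_eq[OF _ e2 fm])
  qed
  have "(LINT s|?M. tri_ext T e\<^sub>1 x s *v triangular_op \<rho>\<^sub>2 e\<^sub>2 f s) =
      (LINT s|?M. tri_ext T e\<^sub>1 x s *v (\<rho>\<^sub>2 s *v f s) +
         tri_ext T e\<^sub>1 x s *v (LINT t|?M. tri_ext T e\<^sub>2 s t *v f t))"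
    by (intro Bochner_Integration.integral_cong refl)
      (simp add: triangular_op_eq[OF _ e2 fm] matrix_vector_right_distrib)
  also have "\<dots> = (LINT t|?M. tri_ext T e\<^sub>1 x t *v (\<rho>\<^sub>2 t *v f t)) +
      (LINT t|?M. tri_ext T ?k x t *v f t)"
    using integrable_tri_ext[OF e1 \<rho>f] integrable_tri_ext[OF e1 I2]
    by (simp add: LINT_tri_ext_swap[OF e1 e2 f x])
  finally have "triangular_op \<rho>\<^sub>1 e\<^sub>1 (triangular_op \<rho>\<^sub>2 e\<^sub>2 f) x =
      \<rho>\<^sub>1 x *v (\<rho>\<^sub>2 x *v f x) + (\<rho>\<^sub>1 x *v (LINT t|?M. tri_ext T e\<^sub>2 x t *v f t)
      + (LINT t|?M. tri_ext T e\<^sub>1 x t *v (\<rho>\<^sub>2 t *v f t)) + (LINT t|?M. tri_ext T ?k x t *v f t))"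
    by (simp add: triangular_op_eq[OF x e1 L2_D(1)[OF g]] triangular_op_eq[OF x e2 fm]
      matrix_vector_right_distrib)
  also have "\<rho>\<^sub>1 x *v (LINT t|?M. tri_ext T e\<^sub>2 x t *v f t)
      + (LINT t|?M. tri_ext T e\<^sub>1 x t *v (\<rho>\<^sub>2 t *v f t)) + (LINT t|?M. tri_ext T ?k x t *v f t) =
      (LINT t|?M. tri_ext T (comp_kernel \<rho>\<^sub>1 e\<^sub>1 \<rho>\<^sub>2 e\<^sub>2) x t *v f t)"
  proof -
    have bl: "bounded_linear (\<lambda>v. \<rho>\<^sub>1 x *v v)"
      by (rule bounded_bilinear.bounded_linear_right[OF bounded_bilinear_matrix_vector_mult])
    have "(LINT t|?M. tri_ext T (comp_kernel \<rho>\<^sub>1 e\<^sub>1 \<rho>\<^sub>2 e\<^sub>2) x t *v f t) =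
       (LINT t|?M. \<rho>\<^sub>1 x *v (tri_ext T e\<^sub>2 x t *v f t) + tri_ext T e\<^sub>1 x t *v (\<rho>\<^sub>2 t *v f t)
          + tri_ext T ?k x t *v f t)"
      by (intro Bochner_Integration.integral_cong refl)
        (simp add: tri_ext_def comp_kernel_def indicator_def matrix_vector_mul_assoc matrix_vector_mult_add_rdistrib)
    also have "\<dots> = \<rho>\<^sub>1 x *v (LINT t|?M. tri_ext T e\<^sub>2 x t *v f t)
      + (LINT t|?M. tri_ext T e\<^sub>1 x t *v (\<rho>\<^sub>2 t *v f t)) + (LINT t|?M. tri_ext T ?k x t *v f t)"
      using integrable_tri_ext[OF e1 \<rho>f, of x] integrable_bounded_linear[OF bl integrable_tri_ext[OF e2 fi, of x]]
        integrable_tri_ext[OF continuous_on_kernel_integral[OF e1 e2] fi, of x]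
        integral_bounded_linear[OF bl integrable_tri_ext[OF e2 fi, of x]]
      by simp
    finally show ?thesis by simp
  qed
  finally show ?thesis
    by (simp add: triangular_op_eq[OF x continuous_on_comp_kernel[OF \<rho>1 e1 \<rho>2 e2] fm] matrix_vector_mul_assoc)
qed

section \<open>Volterra equations and inversion of triangular operators\<close>

text \<open>Picard iteration on the triangle with t as a parameter: solving for all t at once gives
  joint continuity. The value at (x,t) involves only points (s,t) with s <= x, so a weight in the
  first variable is enough.\<close>

lemma volterra_kernel_equation:
  fixes k :: "real \<Rightarrow> real \<Rightarrow> complex^'n^'n" and a :: "real \<Rightarrow> real \<Rightarrow> complex^'m^'n"
  assumes k: "continuous_on (triangle T) (\<lambda>(x, t). k x t)"
    and a: "continuous_on (triangle T) (\<lambda>(x, t). a x t)"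
  obtains r where "continuous_on (triangle T) (\<lambda>(x, t). r x t)"
    "\<And>x t. (x, t) \<in> triangle T \<Longrightarrow> r x t = a x t + integral {t..x} (\<lambda>s. k x s ** r s t)"
proof -
  obtain C where C: "0 \<le> C" "\<And>x t. norm (tri_ext T k x t) \<le> C"
    using tri_ext_bounded[OF k] by metis
  obtain L where L: "0 \<le> L" "\<And>(A::complex^'n^'n) (B::complex^'m^'n). norm (A ** B) \<le> norm A * norm B * L"
    using bounded_bilinear.nonneg_bounded[OF bounded_bilinear_matrix_mult] by metis
  \<comment> \<open>Large enough for a factor 1/2 after \<open>norm_integral_le_exp\<close>; the
    added 1 keeps \<open>M\<close> positive when \<open>C * L\<close> is zero.\<close>
  define M where "M = 2 * (C * L) + 1"
  have CL: "0 \<le> C * L" using C L by simp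
  then have M0: "0 < M" unfolding M_def by linarith
  then have M: "0 < M" "C * L / M \<le> 1 / 2" by (simp_all add: pos_divide_le_eq M_def)
  let ?\<Phi> = "\<lambda>g (x, t). a x t + integral {t..x} (\<lambda>s. k x s ** g (s, t))"
  have cu: "continuous_on {t..x} (\<lambda>s. k x s ** g (s, t))"
    if "continuous_on (triangle T) g" "(x, t) \<in> triangle T" for g x t
    by (intro continuous_intros continuous_on_triangle_compose[OF k] continuous_on_compose2[OF that(1)])
      (use that(2) in \<open>auto simp: triangle_def\<close>)
  obtain g where g: "continuous_on (triangle T) g" "\<And>p. p \<in> triangle T \<Longrightarrow> g p = ?\<Phi> g p"
  proof (rule weighted_contraction_fixpoint[OF compact_triangle])
    show "continuous_on (triangle T) (\<lambda>p. exp (M * fst p))" by (intro continuous_intros)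
    show "continuous_on (triangle T) (?\<Phi> g)" if "continuous_on (triangle T) g" for g
    proof -
      have "continuous_on (triangle T) (\<lambda>(x, t). integral {t..x} (\<lambda>s. k x s ** (\<lambda>x t. g (x, t)) s t))"
        by (rule continuous_on_kernel_integral[OF k]) (use that in simp)
      then show ?thesis using a unfolding case_prod_unfold by (intro continuous_intros) auto
    qed
  next
    fix g h :: "real \<times> real \<Rightarrow> complex^'m^'n" and D p
    assume g: "continuous_on (triangle T) g" and h: "continuous_on (triangle T) h" and D: "0 \<le> (D::real)"
      and le: "\<And>p. p \<in> triangle T \<Longrightarrow> norm (g p - h p) \<le> D * exp (M * fst p)" and p: "p \<in> triangle T"
    obtain x t where xt: "p = (x, t)" by fastforce
    have "norm (integral {t..x} (\<lambda>s. k x s ** g (s, t) - k x s ** h (s, t))) \<le> C * L * D / M * exp (M * x)"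
    proof (rule norm_integral_le_exp)
      fix s assume s: "t \<le> s" "s \<le> x"
      have "norm (k x s ** g (s, t) - k x s ** h (s, t)) = norm (tri_ext T k x s ** (g (s, t) - h (s, t)))"
        using s p by (simp add: tri_ext_def triangle_def xt
            bounded_bilinear.diff_right[OF bounded_bilinear_matrix_mult])
      also have "\<dots> \<le> C * (D * exp (M * s)) * L"
        by (intro order_trans[OF L(2)] mult_right_mono mult_mono C L norm_ge_zero)
          (use le[of "(s, t)"] s p in \<open>auto simp: triangle_def xt\<close>)
      finally show "norm (k x s ** g (s, t) - k x s ** h (s, t)) \<le> C * L * D * exp (M * s)"
        by (simp add: mult_ac)
    qed (use cu[OF g] cu[OF h] p M C L D in \<open>auto intro!: continuous_on_diff simp: xt triangle_def\<close>)
    also have "\<dots> \<le> D / 2 * exp (M * x)"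
      using mult_left_mono[OF M(2) D] by (intro mult_right_mono) (auto simp: mult_ac)
    finally show "norm (?\<Phi> g p - ?\<Phi> h p) \<le> D / 2 * exp (M * fst p)"
      using integral_diff[OF integrable_continuous_interval[OF cu[OF g]] integrable_continuous_interval[OF cu[OF h]]] p
      by (simp add: xt)
  qed auto
  show ?thesis
    by (rule that[of "\<lambda>x t. g (x, t)"]) (use g in auto)
qed

text \<open>The maps \<open>P\<close> outside and \<open>Q\<close> inside the integral are kept
  apart, and the integral lives in its own space. A linear differential equation has the identity
  for \<open>P\<close>; inverting K leads to -F' outside and G inside, with an integral of p
  components for an unknown with r.\<close>

lemma volterra_equation:
  fixes P :: "real \<Rightarrow> 'c::euclidean_space \<Rightarrow> 'b::banach" and Q :: "real \<Rightarrow> 'b \<Rightarrow> 'c"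
  assumes a: "continuous_on {0..T} a" and B: "0 \<le> B"
    and P: "\<And>g. continuous_on {0..T} g \<Longrightarrow> continuous_on {0..T} (\<lambda>s. P s (g s))"
      "\<And>s y z. s \<in> {0..T} \<Longrightarrow> norm (P s y - P s z) \<le> B * norm (y - z)"
    and Q: "\<And>g. continuous_on {0..T} g \<Longrightarrow> continuous_on {0..T} (\<lambda>s. Q s (g s))"
      "\<And>s y z. s \<in> {0..T} \<Longrightarrow> norm (Q s y - Q s z) \<le> B * norm (y - z)"
  obtains g where "continuous_on {0..T} g"
    "\<And>x. x \<in> {0..T} \<Longrightarrow> g x = a x + P x (integral {0..x} (\<lambda>s. Q s (g s)))"
proof (rule weighted_contraction_fixpoint[of "{0..T}"])
  \<comment> \<open>Each of \<open>P\<close> and \<open>Q\<close> contributes a factor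
    \<open>B\<close>, and the integral a factor 1/M.\<close>
  define M where "M = 2 * (B * B) + 1"
  have BB: "0 \<le> B * B" using B by simp
  then have M0: "0 < M" unfolding M_def by linarith
  then have M: "0 < M" "B * (B / M) \<le> 1 / 2" by (simp_all add: pos_divide_le_eq M_def)
  show "continuous_on {0..T} (\<lambda>x. exp (M * x))" by (intro continuous_intros)
  show "continuous_on {0..T} (\<lambda>x. a x + P x (integral {0..x} (\<lambda>s. Q s (g s))))"
    if "continuous_on {0..T} g" for g
    by (intro continuous_intros a P(1) indefinite_integral_continuous_1 integrable_continuous_interval Q(1) that)
  fix g h :: "real \<Rightarrow> 'b" and D x
  assume g: "continuous_on {0..T} g" and h: "continuous_on {0..T} h" and D: "0 \<le> (D::real)"
    and le: "\<And>x. x \<in> {0..T} \<Longrightarrow> norm (g x - h x) \<le> D * exp (M * x)" and x: "x \<in> {0..T}"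
  have c: "continuous_on {0..x} (\<lambda>s. Q s (u s))" if "continuous_on {0..T} u" for u
    by (rule continuous_on_subset[OF Q(1)[OF that]]) (use x in auto)
  have "norm (integral {0..x} (\<lambda>s. Q s (g s) - Q s (h s))) \<le> B * D / M * exp (M * x)"
  proof (rule norm_integral_le_exp)
    fix s assume s: "0 \<le> s" "s \<le> x"
    show "norm (Q s (g s) - Q s (h s)) \<le> B * D * exp (M * s)"
      using Q(2)[of s "g s" "h s"] mult_left_mono[OF le B, of s] s x by simp
  qed (use c[OF g] c[OF h] x M B D in \<open>auto intro!: continuous_on_diff\<close>)
  then have 1: "norm (integral {0..x} (\<lambda>s. Q s (g s)) - integral {0..x} (\<lambda>s. Q s (h s))) \<le> B * D / M * exp (M * x)"
    using integral_diff[OF integrable_continuous_interval[OF c[OF g]] integrable_continuous_interval[OF c[OF h]]]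
    by simp
  have "norm (P x (integral {0..x} (\<lambda>s. Q s (g s))) - P x (integral {0..x} (\<lambda>s. Q s (h s)))) \<le> B * (B * D / M * exp (M * x))"
    by (rule order_trans[OF P(2)[OF x] mult_left_mono[OF 1 B]])
  also have "\<dots> \<le> D / 2 * exp (M * x)"
    using mult_right_mono[OF mult_left_mono[OF M(2) D], of "exp (M * x)"] by (simp add: mult_ac)
  finally show "norm (a x + P x (integral {0..x} (\<lambda>s. Q s (g s))) - (a x + P x (integral {0..x} (\<lambda>s. Q s (h s)))))
      \<le> D / 2 * exp (M * x)" by simp
qed (use that in auto)

lemmas matrix_bilinear_simps =
  bounded_bilinear.add_left[OF bounded_bilinear_matrix_mult]
  bounded_bilinear.add_right[OF bounded_bilinear_matrix_mult]
  bounded_bilinear.diff_left[OF bounded_bilinear_matrix_mult]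
  bounded_bilinear.diff_right[OF bounded_bilinear_matrix_mult]
  bounded_bilinear.minus_left[OF bounded_bilinear_matrix_mult]
  bounded_bilinear.minus_right[OF bounded_bilinear_matrix_mult]

lemmas has_vector_derivative_matrix_mult [derivative_intros] =
  bounded_bilinear.has_vector_derivative[OF bounded_bilinear_matrix_mult]
lemmas has_vector_derivative_matrix_vector_mult [derivative_intros] =
  bounded_bilinear.has_vector_derivative[OF bounded_bilinear_matrix_vector_mult]

lemma integral_matrix_mult_left:
  fixes A :: "complex^'n^'m" and h :: "real \<Rightarrow> complex^'k^'n"
  assumes "continuous_on {a..b} h"
  shows "integral {a..b} (\<lambda>s. A ** h s) = A ** integral {a..b} h"
  using integral_linear[OF integrable_continuous_interval[OF assms]
      bounded_bilinear.bounded_linear_right[OF bounded_bilinear_matrix_mult, of A]]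
  by (simp add: o_def)

lemma triangular_op_cong:
  assumes "x \<in> {0..T}" "\<rho> x = \<rho>' x" "\<And>t. \<lbrakk>0 \<le> t; t \<le> x\<rbrakk> \<Longrightarrow> e x t = e' x t"
    "\<And>t. \<lbrakk>0 \<le> t; t \<le> x\<rbrakk> \<Longrightarrow> f t = g t"
  shows "triangular_op \<rho> e f x = triangular_op \<rho>' e' g x"
proof -
  have "(LINT t:{0..x}|lebesgue. e x t *v f t) = (LINT t:{0..x}|lebesgue. e' x t *v g t)"
    unfolding set_lebesgue_integral_def
    by (rule Bochner_Integration.integral_cong) (use assms in \<open>auto simp: indicator_def\<close>)
  then show ?thesis using assms by (simp add: triangular_op_def)
qed

lemma ae_eq_sym: "ae_eq T f g \<Longrightarrow> ae_eq T g f"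
  unfolding ae_eq_def by (auto elim: eventually_mono)

lemma ae_eq_trans [trans]: "ae_eq T f g \<Longrightarrow> ae_eq T g h \<Longrightarrow> ae_eq T f h"
  unfolding ae_eq_def by (auto elim: eventually_elim2)

lemma bounded_opD:
  assumes "bounded_op T S"
  shows "f \<in> L2 T \<Longrightarrow> S f \<in> L2 T"
    and "\<lbrakk>f \<in> L2 T; g \<in> L2 T; ae_eq T f g\<rbrakk> \<Longrightarrow> ae_eq T (S f) (S g)"
    and "\<lbrakk>f \<in> L2 T; g \<in> L2 T\<rbrakk> \<Longrightarrow> ae_eq T (S (\<lambda>x. f x + g x)) (\<lambda>x. S f x + S g x)"
  using assms by (auto simp: bounded_op_def)

text \<open>The product has multiplication part \<rho>\<tau> = 1. Requiring its
  \<open>comp_kernel\<close> to vanish and multiplying by \<open>\<tau> x\<close> from the left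
  gives a Volterra equation of the second kind for \<open>e'\<close>; the proof solves it and
  multiplies back by \<open>\<rho> x\<close>.\<close>

lemma triangular_op_right_inverse:
  fixes \<rho> \<tau> :: "real \<Rightarrow> complex^'r^'r" and e :: "real \<Rightarrow> real \<Rightarrow> complex^'r^'r"
  assumes T: "0 < T" and \<rho>: "continuous_on {0..T} \<rho>" and \<tau>: "continuous_on {0..T} \<tau>"
    and inv: "\<And>x. x \<in> {0..T} \<Longrightarrow> \<rho> x ** \<tau> x = mat 1"
    and e: "continuous_on (triangle T) (\<lambda>(x, t). e x t)"
  obtains e' where "continuous_on (triangle T) (\<lambda>(x, t). e' x t)"
    "\<And>f x. \<lbrakk>f \<in> L2 T; x \<in> {0<..<T}\<rbrakk> \<Longrightarrow> triangular_op \<rho> e (triangular_op \<tau> e' f) x = f x"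
proof -
  have \<tau>1: "continuous_on (triangle T) (\<lambda>p. \<tau> (fst p))" and \<tau>2: "continuous_on (triangle T) (\<lambda>p. \<tau> (snd p))"
    by (auto intro!: continuous_on_compose2[OF \<tau>] continuous_intros simp: triangle_def)
  have k: "continuous_on (triangle T) (\<lambda>(x, t). - (\<tau> x ** e x t))"
    "continuous_on (triangle T) (\<lambda>(x, t). - (\<tau> x ** e x t ** \<tau> t))"
    using e \<tau>1 \<tau>2 unfolding case_prod_unfold by (auto intro!: continuous_intros)
  obtain e' where e': "continuous_on (triangle T) (\<lambda>(x, t). e' x t)"
    and eq: "\<And>x t. (x, t) \<in> triangle T \<Longrightarrow> e' x t = - (\<tau> x ** e x t ** \<tau> t) + integral {t..x} (\<lambda>s. - (\<tau> x ** e x s) ** e' s t)"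
    using volterra_kernel_equation[OF k] by blast
  have zero: "comp_kernel \<rho> e \<tau> e' x t = 0" if xt: "(x, t) \<in> triangle T" for x t
  proof -
    have x: "x \<in> {0..T}" using xt by (auto simp: triangle_def)
    have c: "continuous_on {t..x} (\<lambda>s. e x s ** e' s t)"
      by (intro continuous_intros continuous_on_triangle_compose[OF e] continuous_on_triangle_compose[OF e'])
        (use xt in \<open>auto simp: triangle_def\<close>)
    have "e' x t = - (\<tau> x ** e x t ** \<tau> t) - \<tau> x ** integral {t..x} (\<lambda>s. e x s ** e' s t)"
      by (simp add: eq[OF xt] matrix_bilinear_simps matrix_mul_assoc[symmetric] integral_matrix_mult_left[OF c])
    then have "\<rho> x ** e' x t = - (\<rho> x ** \<tau> x ** e x t ** \<tau> t) - \<rho> x ** \<tau> x ** integral {t..x} (\<lambda>s. e x s ** e' s t)"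
      by (simp add: matrix_bilinear_simps matrix_mul_assoc)
    then show ?thesis
      using xt by (simp add: comp_kernel_def inv[OF x] matrix_bilinear_simps)
  qed
  show ?thesis
  proof (rule that[OF e'])
    fix f :: "real \<Rightarrow> complex^'r" and x assume f: "f \<in> L2 T" and x: "x \<in> {0<..<T}"
    have "triangular_op (\<lambda>x. \<rho> x ** \<tau> x) (comp_kernel \<rho> e \<tau> e') f x = triangular_op (\<lambda>_. mat 1) (\<lambda>_ _. 0) f x"
      by (rule triangular_op_cong[of _ T]) (use x zero inv in \<open>auto simp: triangle_def\<close>)
    then show "triangular_op \<rho> e (triangular_op \<tau> e' f) x = f x"
      by (simp add: triangular_op_comp[OF T \<rho> e \<tau> e' f x]) (simp add: triangular_op_def)
  qed
qed

text \<open>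
  Right inverses suffice: a right inverse of the same form has itself a right inverse, which must
  then be the original operator.
\<close>

lemma triangular_op_inverse:
  fixes \<rho> \<tau> :: "real \<Rightarrow> complex^'r^'r" and e :: "real \<Rightarrow> real \<Rightarrow> complex^'r^'r"
  assumes T: "0 < T" and \<rho>: "continuous_on {0..T} \<rho>" and \<tau>: "continuous_on {0..T} \<tau>"
    and inv: "\<And>x. x \<in> {0..T} \<Longrightarrow> \<rho> x ** \<tau> x = mat 1"
    and e: "continuous_on (triangle T) (\<lambda>(x, t). e x t)"
  obtains e' where "continuous_on (triangle T) (\<lambda>(x, t). e' x t)"
    "inverse_ops T (triangular_op \<rho> e) (triangular_op \<tau> e')"
proof -
  have inv': "\<tau> x ** \<rho> x = mat 1" if "x \<in> {0..T}" for x
    using inv[OF that] by (simp add: matrix_left_right_inverse)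
  obtain e' where e': "continuous_on (triangle T) (\<lambda>(x, t). e' x t)"
    and SR: "\<And>f x. \<lbrakk>f \<in> L2 T; x \<in> {0<..<T}\<rbrakk> \<Longrightarrow> triangular_op \<rho> e (triangular_op \<tau> e' f) x = f x"
    using triangular_op_right_inverse[OF T \<rho> \<tau> inv e] by blast
  obtain e'' where e'': "continuous_on (triangle T) (\<lambda>(x, t). e'' x t)"
    and RQ: "\<And>f x. \<lbrakk>f \<in> L2 T; x \<in> {0<..<T}\<rbrakk> \<Longrightarrow> triangular_op \<tau> e' (triangular_op \<rho> e'' f) x = f x"
    using triangular_op_right_inverse[OF T \<tau> \<rho> inv' e'] by blast
  let ?S = "triangular_op \<rho> e" and ?R = "triangular_op \<tau> e'" and ?Q = "triangular_op \<rho> e''"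
  note S = bounded_op_triangular[OF T \<rho> e] and R = bounded_op_triangular[OF T \<tau> e']
    and Q = bounded_op_triangular[OF T \<rho> e'']
  have "ae_eq T (?R (?S f)) f" if f: "f \<in> L2 T" for f
  proof -
    note Qf = bounded_opD(1)[OF Q f]
    have "ae_eq T (?S f) (?S (?R (?Q f)))"
      by (intro bounded_opD(2)[OF S f] bounded_opD(1)[OF R] Qf ae_eqI) (simp add: RQ f)
    also have "ae_eq T \<dots> (?Q f)"
      by (intro ae_eqI SR Qf)
    finally have "ae_eq T (?R (?S f)) (?R (?Q f))"
      by (intro bounded_opD(2)[OF R] bounded_opD(1)[OF S] Qf f)
    also have "ae_eq T \<dots> f"
      by (intro ae_eqI RQ f)
    finally show ?thesis .
  qed
  then show ?thesis
    using S R SR by (intro that[OF e']) (auto simp: inverse_ops_def intro!: ae_eqI)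
qed

section \<open>The transformation kernel\<close>

text \<open>The general bilinear \<open>m\<close> covers both orders of the matrix product: the
  coefficient on the left of the unknown and, with the flipped product, on its right.\<close>

lemma linear_ode:
  fixes A :: "real \<Rightarrow> 'a::real_normed_vector" and m :: "'a \<Rightarrow> 'b::euclidean_space \<Rightarrow> 'b"
  assumes m: "bounded_bilinear m" and A: "continuous_on {0..T} A"
  obtains g where "g 0 = c" "\<And>x. x \<in> {0..T} \<Longrightarrow> (g has_vector_derivative m (A x) (g x)) (at x within {0..T})"
proof -
  obtain C where C: "0 \<le> C" "\<And>x. x \<in> {0..T} \<Longrightarrow> norm (A x) \<le> C"
    using bounded_on_interval[OF A] by metis
  obtain L where L: "0 \<le> L" "\<And>x y. norm (m x y) \<le> norm x * norm y * L"
    using bounded_bilinear.nonneg_bounded[OF m] by metis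
  have cont: "continuous_on {0..T} (\<lambda>s. m (A s) (g s))" if "continuous_on {0..T} g" for g
    by (rule bounded_bilinear.continuous_on[OF m A that])
  have lip: "norm (m (A s) y - m (A s) z) \<le> (C * L + 1) * norm (y - z)" if "s \<in> {0..T}" for s y z
  proof -
    have "norm (m (A s) (y - z)) \<le> C * norm (y - z) * L"
      by (intro order_trans[OF L(2)] mult_right_mono C L norm_ge_zero that)
    also have "\<dots> \<le> (C * L + 1) * norm (y - z)" by (simp add: algebra_simps)
    finally show ?thesis by (simp add: bounded_bilinear.diff_right[OF m])
  qed
  have triv: "norm (y - z) \<le> (C * L + 1) * norm (y - z)" for y z :: 'b
    using C(1) L(1) by (simp add: algebra_simps)
  obtain h where h: "continuous_on {0..T} h"
    "\<And>x. x \<in> {0..T} \<Longrightarrow> h x = c + integral {0..x} (\<lambda>s. m (A s) (h s))"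
    \<comment> \<open>One constant has to serve both maps: \<open>C * L\<close> for
      \<open>m (A s)\<close>, and 1 for the identity outside the integral.\<close>
    by (rule volterra_equation[of T "\<lambda>_. c" "C * L + 1" "\<lambda>_ y. y" "\<lambda>s. m (A s)"])
      (use C L cont lip triv in auto)
  \<comment> \<open>\<open>h\<close> is known to satisfy its equation only on \<open>{0..T}\<close>.
    Defining \<open>g\<close> by the right-hand side gives the initial value and the derivative at
    once, and \<open>g\<close> equals \<open>h\<close> on the interval.\<close>
  define g where "g x = c + integral {0..x} (\<lambda>s. m (A s) (h s))" for x
  show ?thesis
  proof (rule that[of g])
    show "g 0 = c" by (simp add: g_def)
    fix x assume x: "x \<in> {0..T}"
    have "(g has_vector_derivative 0 + m (A x) (h x)) (at x within {0..T})"
      unfolding g_def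
      by (intro has_vector_derivative_add has_vector_derivative_const integral_has_vector_derivative cont h(1) x)
    then show "(g has_vector_derivative m (A x) (g x)) (at x within {0..T})"
      using h(2)[OF x] by (simp add: g_def)
  qed
qed

lemma has_vector_derivative_imp_continuous_on:
  assumes "\<And>x. x \<in> S \<Longrightarrow> (f has_vector_derivative f' x) (at x within S)"
  shows "continuous_on S f"
  using assms by (meson continuous_on_eq_continuous_within has_vector_derivative_continuous)

text \<open>\<tau> solves the adjoint equation \<tau>' = -\<tau>A, so the two terms of
  (\<tau>\<rho>)' cancel without commuting anything. Thus \<tau>\<rho> is constantly 1, and
  squareness gives the other order.\<close>

lemma fundamental_matrix:
  fixes A :: "real \<Rightarrow> complex^'n^'n"
  assumes A: "continuous_on {0..T} A"
  obtains \<rho> \<tau> where "\<rho> 0 = mat 1"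
    "\<And>x. x \<in> {0..T} \<Longrightarrow> (\<rho> has_vector_derivative A x ** \<rho> x) (at x within {0..T})"
    "continuous_on {0..T} \<tau>" "\<And>x. x \<in> {0..T} \<Longrightarrow> \<rho> x ** \<tau> x = mat 1"
proof -
  obtain \<rho> where \<rho>: "\<rho> 0 = mat 1"
    "\<And>x. x \<in> {0..T} \<Longrightarrow> (\<rho> has_vector_derivative A x ** \<rho> x) (at x within {0..T})"
    using linear_ode[OF bounded_bilinear_matrix_mult A, of "mat 1 :: complex^'n^'n"] by blast
  have A': "continuous_on {0..T} (\<lambda>x. - A x)" by (intro continuous_intros A)
  obtain \<tau> where \<tau>: "\<tau> 0 = mat 1"
    "\<And>x. x \<in> {0..T} \<Longrightarrow> (\<tau> has_vector_derivative \<tau> x ** (- A x)) (at x within {0..T})"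
    using linear_ode[OF bounded_bilinear.flip[OF bounded_bilinear_matrix_mult] A', of "mat 1 :: complex^'n^'n"] by blast
  have "((\<lambda>x. \<tau> x ** \<rho> x) has_vector_derivative 0) (at x within {0..T})" if "x \<in> {0..T}" for x
    using has_vector_derivative_matrix_mult[OF \<tau>(2)[OF that] \<rho>(2)[OF that]]
    by (simp add: matrix_bilinear_simps matrix_mul_assoc)
  then obtain c where c: "\<And>x. x \<in> {0..T} \<Longrightarrow> \<tau> x ** \<rho> x = c"
    using has_vector_derivative_zero_constant[of "{0..T}" "\<lambda>x. \<tau> x ** \<rho> x"] by auto
  have "\<rho> x ** \<tau> x = mat 1" if "x \<in> {0..T}" for x
    using c[OF that] c[of 0] \<rho>(1) \<tau>(1) that
    by (subst matrix_left_right_inverse) simp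
  then show ?thesis
    using that \<rho> has_vector_derivative_imp_continuous_on[OF \<tau>(2)] by blast
qed

section \<open>The kernels k and q\<close>

text \<open>Write u~ and w~ for the transformed unknowns. Variation of constants turns u~' = zu~ + b
  w~ into e^{zx} plus the integral of e^{z(x-s)} b(s) w~(s). Inserting the ansatz for w~ with
  variable t' and collecting e^{zt}, where t = x - s + t', leaves \<open>q s (s - (x - t))\<close>:
  an integral along a line s - t' = const. Integrating w~' = c u~ gives the equation for
  \<open>q\<close>. Both right-hand sides use only points with first coordinate at most x, so one
  exponential weight serves the pair.\<close>

lemma transformation_kernels:
  fixes b :: "real \<Rightarrow> complex^'p^'r" and c :: "real \<Rightarrow> complex^'r^'p"
  assumes b: "continuous_on {0..T} b" and c: "continuous_on {0..T} c"
  obtains k :: "real \<Rightarrow> real \<Rightarrow> complex^'r^'r" and q :: "real \<Rightarrow> real \<Rightarrow> complex^'r^'p"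
  where "continuous_on (triangle T) (\<lambda>(x, t). k x t)" "continuous_on (triangle T) (\<lambda>(x, t). q x t)"
    "\<And>x t. (x, t) \<in> triangle T \<Longrightarrow> k x t = integral {x - t..x} (\<lambda>s. b s ** q s (s - (x - t)))"
    "\<And>x t. (x, t) \<in> triangle T \<Longrightarrow> q x t = c t + integral {t..x} (\<lambda>s. c s ** k s t)"
proof -
  obtain Cb where Cb: "0 \<le> Cb" "\<And>x. x \<in> {0..T} \<Longrightarrow> norm (b x) \<le> Cb"
    using bounded_on_interval[OF b] by metis
  obtain Cc where Cc: "0 \<le> Cc" "\<And>x. x \<in> {0..T} \<Longrightarrow> norm (c x) \<le> Cc"
    using bounded_on_interval[OF c] by metis
  obtain Lb where Lb: "0 \<le> Lb" "\<And>(A::complex^'p^'r) (B::complex^'r^'p). norm (A ** B) \<le> norm A * norm B * Lb"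
    using bounded_bilinear.nonneg_bounded[OF bounded_bilinear_matrix_mult] by metis
  obtain Lc where Lc: "0 \<le> Lc" "\<And>(A::complex^'r^'p) (B::complex^'r^'r). norm (A ** B) \<le> norm A * norm B * Lc"
    using bounded_bilinear.nonneg_bounded[OF bounded_bilinear_matrix_mult] by metis
  \<comment> \<open>Each component is to contract by 1/4; the sum of the two, which bounds the norm
    of the pair, then contracts by 1/2.\<close>
  define M where "M = 4 * (Cb * Lb) + 4 * (Cc * Lc) + 1"
  have "0 \<le> Cb * Lb" "0 \<le> Cc * Lc" using Cb Cc Lb Lc by simp_all
  then have "0 < M" "4 * (Cb * Lb) \<le> M" "4 * (Cc * Lc) \<le> M" unfolding M_def by linarith+
  then have M: "0 < M" "Cb * Lb \<le> M / 4" "Cc * Lc \<le> M / 4" by simp_all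
  let ?\<Phi>1 = "\<lambda>g p. integral {fst p - snd p..fst p} (\<lambda>s. b s ** snd (g (s, s - (fst p - snd p))))"
  let ?\<Phi>2 = "\<lambda>g p. c (snd p) + integral {snd p..fst p} (\<lambda>s. c s ** fst (g (s, snd p)))"
  let ?\<Phi> = "\<lambda>g p. (?\<Phi>1 g p, ?\<Phi>2 g p)"
  have c1: "continuous_on {fst p - snd p..fst p} (\<lambda>s. b s ** snd (g (s, s - (fst p - snd p))))"
    and c2: "continuous_on {snd p..fst p} (\<lambda>s. c s ** fst (g (s, snd p)))"
    if "continuous_on (triangle T) g" "p \<in> triangle T" for g :: "real \<times> real \<Rightarrow> (complex^'r^'r) \<times> (complex^'r^'p)" and p
    by (intro continuous_intros continuous_on_compose2[OF b] continuous_on_compose2[OF c] continuous_on_compose2[OF that(1)];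
        use that(2) in \<open>auto simp: triangle_def\<close>)+
  obtain g where g: "continuous_on (triangle T) g" "\<And>p. p \<in> triangle T \<Longrightarrow> g p = ?\<Phi> g p"
  proof (rule weighted_contraction_fixpoint[OF compact_triangle])
    show "continuous_on (triangle T) (\<lambda>p. exp (M * fst p))" by (intro continuous_intros)
    fix g :: "real \<times> real \<Rightarrow> (complex^'r^'r) \<times> (complex^'r^'p)"
    assume g: "continuous_on (triangle T) g"
    have "continuous_on (triangle T) (?\<Phi>1 g)"
    proof (rule continuous_on_integral_limits)
      show "continuous_on {(p, s). p \<in> triangle T \<and> fst p - snd p \<le> s \<and> s \<le> fst p}
          (\<lambda>(p, s). b s ** snd (g (s, s - (fst p - snd p))))"
        unfolding case_prod_unfold
        by (intro continuous_intros continuous_on_compose2[OF b] continuous_on_compose2[OF g])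
          (auto simp: triangle_def)
    qed (auto intro!: continuous_intros simp: triangle_def)
    moreover have "continuous_on (triangle T) (\<lambda>p. integral {snd p..fst p} (\<lambda>s. c s ** fst (g (s, snd p))))"
    proof (rule continuous_on_integral_limits)
      show "continuous_on {(p, s). p \<in> triangle T \<and> snd p \<le> s \<and> s \<le> fst p}
          (\<lambda>(p, s). c s ** fst (g (s, snd p)))"
        unfolding case_prod_unfold
        by (intro continuous_intros continuous_on_compose2[OF c] continuous_on_compose2[OF g])
          (auto simp: triangle_def)
    qed (auto intro!: continuous_intros simp: triangle_def)
    moreover have "continuous_on (triangle T) (\<lambda>p. c (snd p))"
      by (intro continuous_on_compose2[OF c] continuous_intros) (auto simp: triangle_def)
    ultimately show "continuous_on (triangle T) (?\<Phi> g)"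
      by (intro continuous_intros)
  next
    fix g h :: "real \<times> real \<Rightarrow> (complex^'r^'r) \<times> (complex^'r^'p)" and D p
    assume g: "continuous_on (triangle T) g" and h: "continuous_on (triangle T) h" and D: "0 \<le> (D::real)"
      and le: "\<And>p. p \<in> triangle T \<Longrightarrow> norm (g p - h p) \<le> D * exp (M * fst p)" and p: "p \<in> triangle T"
    obtain x t where xt: "p = (x, t)" by fastforce
    have x: "0 \<le> t" "t \<le> x" "x \<le> T" using p by (auto simp: xt triangle_def)
    have cmp: "norm (fst (g p) - fst (h p)) \<le> D * exp (M * fst p)" "norm (snd (g p) - snd (h p)) \<le> D * exp (M * fst p)"
      if "p \<in> triangle T" for p
      using le[OF that] norm_fst_le[of "fst (g p) - fst (h p)" "snd (g p) - snd (h p)"] norm_snd_le[of "snd (g p) - snd (h p)" "fst (g p) - fst (h p)"]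
      by (simp_all add: fst_diff[symmetric] snd_diff[symmetric] del: fst_diff snd_diff)
    note c1g = c1[OF g p, unfolded xt fst_conv snd_conv] and c1h = c1[OF h p, unfolded xt fst_conv snd_conv]
      and c2g = c2[OF g p, unfolded xt fst_conv snd_conv] and c2h = c2[OF h p, unfolded xt fst_conv snd_conv]
    have "norm (integral {x - t..x} (\<lambda>s. b s ** snd (g (s, s - (x - t))) - b s ** snd (h (s, s - (x - t)))))
        \<le> Cb * Lb * D / M * exp (M * x)"
    proof (rule norm_integral_le_exp)
      fix s assume s: "x - t \<le> s" "s \<le> x"
      have "norm (b s ** (snd (g (s, s - (x - t))) - snd (h (s, s - (x - t))))) \<le> Cb * (D * exp (M * s)) * Lb"
        by (intro order_trans[OF Lb(2)] mult_right_mono mult_mono Cb Lb norm_ge_zero)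
          (use cmp(2)[of "(s, s - (x - t))"] s x in \<open>auto simp: triangle_def\<close>)
      then show "norm (b s ** snd (g (s, s - (x - t))) - b s ** snd (h (s, s - (x - t)))) \<le> Cb * Lb * D * exp (M * s)"
        by (simp add: matrix_bilinear_simps mult_ac)
    qed (use c1g c1h x M Cb Lb D in \<open>auto intro!: continuous_on_diff\<close>)
    also have "\<dots> \<le> D / 4 * exp (M * x)"
      using mult_right_mono[OF M(2) D] M(1) by (intro mult_right_mono) (auto simp: pos_divide_le_eq mult_ac)
    finally have 1: "norm (?\<Phi>1 g p - ?\<Phi>1 h p) \<le> D / 4 * exp (M * x)"
      using integral_diff[OF integrable_continuous_interval[OF c1g] integrable_continuous_interval[OF c1h]]
      by (simp add: xt)
    have "norm (integral {t..x} (\<lambda>s. c s ** fst (g (s, t)) - c s ** fst (h (s, t))))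
        \<le> Cc * Lc * D / M * exp (M * x)"
    proof (rule norm_integral_le_exp)
      fix s assume s: "t \<le> s" "s \<le> x"
      have "norm (c s ** (fst (g (s, t)) - fst (h (s, t)))) \<le> Cc * (D * exp (M * s)) * Lc"
        by (intro order_trans[OF Lc(2)] mult_right_mono mult_mono Cc Lc norm_ge_zero)
          (use cmp(1)[of "(s, t)"] s x in \<open>auto simp: triangle_def\<close>)
      then show "norm (c s ** fst (g (s, t)) - c s ** fst (h (s, t))) \<le> Cc * Lc * D * exp (M * s)"
        by (simp add: matrix_bilinear_simps mult_ac)
    qed (use c2g c2h x M Cc Lc D in \<open>auto intro!: continuous_on_diff\<close>)
    also have "\<dots> \<le> D / 4 * exp (M * x)"
      using mult_right_mono[OF M(3) D] M(1) by (intro mult_right_mono) (auto simp: pos_divide_le_eq mult_ac)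
    finally have 2: "norm (?\<Phi>2 g p - ?\<Phi>2 h p) \<le> D / 4 * exp (M * x)"
      using integral_diff[OF integrable_continuous_interval[OF c2g] integrable_continuous_interval[OF c2h]]
      by (simp add: xt)
    have "norm (?\<Phi> g p - ?\<Phi> h p) \<le> norm (?\<Phi>1 g p - ?\<Phi>1 h p) + norm (?\<Phi>2 g p - ?\<Phi>2 h p)"
      by (simp only: diff_Pair norm_Pair_le)
    with 1 2 show "norm (?\<Phi> g p - ?\<Phi> h p) \<le> D / 2 * exp (M * fst p)"
      by (simp only: xt fst_conv)
  qed auto
  show ?thesis
  proof (rule that[of "\<lambda>x t. fst (g (x, t))" "\<lambda>x t. snd (g (x, t))"])
    show "continuous_on (triangle T) (\<lambda>(x, t). fst (g (x, t)))" "continuous_on (triangle T) (\<lambda>(x, t). snd (g (x, t)))"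
      using g(1) by (auto intro!: continuous_intros simp: case_prod_unfold)
  next
    fix x t assume "(x, t) \<in> triangle T"
    from arg_cong[OF g(2)[OF this], of fst] arg_cong[OF g(2)[OF this], of snd]
    show "fst (g (x, t)) = integral {x - t..x} (\<lambda>s. b s ** snd (g (s, s - (x - t))))"
      "snd (g (x, t)) = c t + integral {t..x} (\<lambda>s. c s ** fst (g (s, t)))"
      unfolding fst_conv snd_conv .
  qed
qed

lemma integral_reflect_interval:
  fixes f :: "real \<Rightarrow> 'a::euclidean_space"
  assumes "continuous_on {a..b} f"
  shows "integral {a..b} (\<lambda>s. f (a + b - s)) = integral {a..b} f"
proof -
  have "(f has_integral integral {a..b} f) (cbox a b)"
    using assms by (auto intro!: integrable_integral integrable_continuous_interval)
  from has_integral_affinity[OF this, of "-1" "a + b"]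
  have "((\<lambda>s. f (a + b - s)) has_integral integral {a..b} f) ((\<lambda>s. a + b - s) ` {a..b})"
    by (simp add: algebra_simps)
  also have "(\<lambda>s. a + b - s) ` {a..b} = {a..b}" by simp
  finally show ?thesis by (rule integral_unique)
qed

text \<open>
  For fixed \<open>t\<close> these are the equations for $(\tilde u, \tilde w)$ with $e^{zx}$ replaced by the
  step function at \<open>t\<close>.
\<close>

lemma transformation_kernel_derivatives:
  fixes b :: "real \<Rightarrow> complex^'p^'r" and c :: "real \<Rightarrow> complex^'r^'p"
    and k :: "real \<Rightarrow> real \<Rightarrow> complex^'r^'r" and q :: "real \<Rightarrow> real \<Rightarrow> complex^'r^'p"
  assumes b: "continuous_on {0..T} b" and c: "continuous_on {0..T} c"
    and k: "continuous_on (triangle T) (\<lambda>(x, t). k x t)" and q: "continuous_on (triangle T) (\<lambda>(x, t). q x t)"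
    and k_eq: "\<And>x t. (x, t) \<in> triangle T \<Longrightarrow> k x t = integral {x - t..x} (\<lambda>s. b s ** q s (s - (x - t)))"
    and q_eq: "\<And>x t. (x, t) \<in> triangle T \<Longrightarrow> q x t = c t + integral {t..x} (\<lambda>s. c s ** k s t)"
    and t: "0 \<le> t" and x: "x \<in> {t..T}"
  shows "((\<lambda>x. mat 1 + integral {t..x} (k x)) has_vector_derivative b x ** integral {t..x} (q x) + k x t) (at x within {t..T})"
    and "((\<lambda>x. integral {t..x} (q x)) has_vector_derivative c x ** (mat 1 + integral {t..x} (k x))) (at x within {t..T})"
proof -
  have k_sec: "continuous_on {t..x} (k x)" and q_sec: "continuous_on {t..x} (q x)" if "x \<in> {t..T}" for x
    by (intro continuous_on_triangle_compose[OF k] continuous_on_triangle_compose[OF q] continuous_intros;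
        use t that in auto)+
  have k_int: "continuous_on {t..T} (\<lambda>x. integral {t..x} (k x))" and q_int: "continuous_on {t..T} (\<lambda>x. integral {t..x} (q x))"
    using t by (auto intro!: continuous_on_integral_limits continuous_intros continuous_on_triangle_compose[OF k]
        continuous_on_triangle_compose[OF q] simp: case_prod_unfold)
  have bt: "continuous_on {t..T} b" and ct: "continuous_on {t..T} c"
    using b c t by (auto intro: continuous_on_subset)
  \<comment> \<open>Inserting the equation for \<open>q\<close> and exchanging the integrals leaves
    x only as an upper limit.\<close>
  have W: "integral {t..x} (q x) = integral {t..x} (\<lambda>r. c r ** (mat 1 + integral {t..r} (k r)))" if x: "x \<in> {t..T}" for x
  proof -
    have sub: "{t..x} \<subseteq> {t..T}" using x by auto
    have ck: "continuous_on {(r, s). t \<le> s \<and> s \<le> r \<and> r \<le> x} (\<lambda>(r, s). c r ** k r s)"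
      unfolding case_prod_unfold using x t
      by (intro continuous_intros continuous_on_compose2[OF c] continuous_on_triangle_compose[OF k]) auto
    have i: "continuous_on {t..x} (\<lambda>s. integral {s..x} (\<lambda>r. c r ** k r s))"
      by (rule continuous_on_integral_limits; (intro continuous_intros)?)
        (use x t in \<open>auto intro!: continuous_intros continuous_on_compose2[OF c]
           continuous_on_triangle_compose[OF k] simp: case_prod_unfold\<close>)
    have cx: "continuous_on {t..x} c" by (rule continuous_on_subset[OF ct sub])
    have "integral {t..x} (q x) = integral {t..x} (\<lambda>s. c s + integral {s..x} (\<lambda>r. c r ** k r s))"
      by (rule integral_cong) (use x t q_eq in \<open>auto simp: triangle_def\<close>)
    also have "\<dots> = integral {t..x} c + integral {t..x} (\<lambda>r. integral {t..r} (\<lambda>s. c r ** k r s))"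
      unfolding integral_triangle_swap[OF ck]
      by (intro integral_add integrable_continuous_interval i cx)
    also have "integral {t..x} (\<lambda>r. integral {t..r} (\<lambda>s. c r ** k r s)) = integral {t..x} (\<lambda>r. c r ** integral {t..r} (k r))"
      by (intro integral_cong integral_matrix_mult_left k_sec) (use x in auto)
    also have "integral {t..x} c + \<dots> = integral {t..x} (\<lambda>r. c r + c r ** integral {t..r} (k r))"
      by (intro integral_add[symmetric] integrable_continuous_interval continuous_intros cx
          continuous_on_subset[OF k_int sub])
    finally show ?thesis by (simp add: matrix_bilinear_simps)
  qed
  \<comment> \<open>\<open>k\<close> need not be differentiable in x, because \<open>q\<close> is
    merely continuous, but its integral over [t,x] is. After reflecting s to t + x - s the section
    is the integral of \<open>g r s\<close> over r from s - t to x. The part up to s is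
    \<open>k s t\<close>; the part beyond s becomes, after an exchange of integrals, the term with b
    and the integral of q.\<close>
  have U: "integral {t..x} (k x) = integral {t..x} (\<lambda>s. b s ** integral {t..s} (q s) + k s t)" if x: "x \<in> {t..T}" for x
  proof -
    have sub: "{t..x} \<subseteq> {t..T}" using x by auto
    define g where "g r s = b r ** q r (r + t - s)" for r s
    \<comment> \<open>The condition s - t <= r, weaker than s <= r, keeps the second argument r + t
      - s nonnegative and includes the part of the integral below s.\<close>
    have g: "continuous_on {(r, s). t \<le> s \<and> s - t \<le> r \<and> s \<le> x \<and> r \<le> x} (\<lambda>(r, s). g r s)"
      unfolding case_prod_unfold g_def using x t
      by (intro continuous_intros continuous_on_compose2[OF b] continuous_on_triangle_compose[OF q]) auto
    have gi: "(\<lambda>r. g r s) integrable_on {u..v}" if "t \<le> s" "s \<le> x" "s - t \<le> u" "v \<le> x" for s u v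
      by (rule integrable_continuous_interval, rule continuous_on_compose2[OF g, where f = "\<lambda>r. (r, s)", simplified])
        (use that in \<open>auto intro!: continuous_intros\<close>)
    have kt: "continuous_on {t..x} (\<lambda>s. k s t)"
      by (intro continuous_on_triangle_compose[OF k] continuous_intros) (use t x in auto)
    have gs: "continuous_on {(r, s). t \<le> s \<and> s \<le> r \<and> r \<le> x} (\<lambda>(r, s). g r s)"
      by (rule continuous_on_subset[OF g]) (use t in auto)
    have i: "continuous_on {t..x} (\<lambda>s. integral {s..x} (\<lambda>r. g r s))"
    proof (rule continuous_on_integral_limits)
      show "continuous_on {(s, r). s \<in> {t..x} \<and> s \<le> r \<and> r \<le> x} (\<lambda>(s, r). g r s)"
        unfolding case_prod_unfold
        by (rule continuous_on_compose2[OF gs, where f = "\<lambda>z. (snd z, fst z)", simplified])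
          (auto intro!: continuous_intros)
    qed (auto intro!: continuous_intros)
    have "integral {t..x} (k x) = integral {t..x} (\<lambda>s. k x (t + x - s))"
      by (rule integral_reflect_interval[symmetric, OF k_sec[OF x]])
    also have "\<dots> = integral {t..x} (\<lambda>s. k s t + integral {s..x} (\<lambda>r. g r s))"
    proof (rule integral_cong)
      fix s assume s: "s \<in> {t..x}"
      have "k x (t + x - s) = integral {s - t..x} (\<lambda>r. g r s)"
        using k_eq[of x "t + x - s"] s x t by (simp add: triangle_def g_def algebra_simps)
      also have "\<dots> = integral {s - t..s} (\<lambda>r. g r s) + integral {s..x} (\<lambda>r. g r s)"
        by (rule Henstock_Kurzweil_Integration.integral_combine[symmetric]) (use s t in \<open>auto intro!: gi\<close>)
      also have "integral {s - t..s} (\<lambda>r. g r s) = k s t"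
        using k_eq[of s t] s x t by (simp add: triangle_def g_def algebra_simps)
      finally show "k x (t + x - s) = k s t + integral {s..x} (\<lambda>r. g r s)" .
    qed
    also have "\<dots> = integral {t..x} (\<lambda>s. k s t) + integral {t..x} (\<lambda>r. integral {t..r} (\<lambda>s. g r s))"
      unfolding integral_triangle_swap[OF gs]
      by (intro integral_add integrable_continuous_interval i kt)
    also have "integral {t..x} (\<lambda>r. integral {t..r} (\<lambda>s. g r s)) = integral {t..x} (\<lambda>r. b r ** integral {t..r} (q r))"
    proof (rule integral_cong)
      fix r assume r: "r \<in> {t..x}"
      then have r': "r \<in> {t..T}" using x by auto
      have "integral {t..r} (\<lambda>s. g r s) = integral {t..r} (\<lambda>s. b r ** q r (t + r - s))"
        by (simp add: g_def add.commute)
      also have "\<dots> = integral {t..r} (\<lambda>s. b r ** q r s)"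
        by (rule integral_reflect_interval) (intro continuous_intros q_sec r')
      also have "\<dots> = b r ** integral {t..r} (q r)"
        by (rule integral_matrix_mult_left[OF q_sec[OF r']])
      finally show "integral {t..r} (\<lambda>s. g r s) = b r ** integral {t..r} (q r)" .
    qed
    also have "integral {t..x} (\<lambda>s. k s t) + \<dots> = integral {t..x} (\<lambda>s. k s t + b s ** integral {t..s} (q s))"
      by (intro integral_add[symmetric] integrable_continuous_interval kt continuous_intros
          continuous_on_subset[OF bt sub] continuous_on_subset[OF q_int sub])
    finally show ?thesis by (simp add: add.commute)
  qed
  have "((\<lambda>x. mat 1 + integral {t..x} (\<lambda>s. b s ** integral {t..s} (q s) + k s t)) has_vector_derivative
      0 + (b x ** integral {t..x} (q x) + k x t)) (at x within {t..T})"
    using t by (intro has_vector_derivative_add has_vector_derivative_const integral_has_vector_derivative x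
        continuous_intros bt q_int continuous_on_triangle_compose[OF k]) auto
  from this[unfolded add_0_left]
  show "((\<lambda>x. mat 1 + integral {t..x} (k x)) has_vector_derivative b x ** integral {t..x} (q x) + k x t) (at x within {t..T})"
    by (rule has_vector_derivative_transform[OF x, rotated]) (simp only: U)
  have "((\<lambda>x. integral {t..x} (\<lambda>r. c r ** (mat 1 + integral {t..r} (k r)))) has_vector_derivative
      c x ** (mat 1 + integral {t..x} (k x))) (at x within {t..T})"
    by (intro integral_has_vector_derivative x continuous_intros ct k_int)
  then show "((\<lambda>x. integral {t..x} (q x)) has_vector_derivative c x ** (mat 1 + integral {t..x} (k x))) (at x within {t..T})"
    by (rule has_vector_derivative_transform[OF x, rotated]) (simp only: W)
qed

section \<open>The intertwining identity for the kernels\<close>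

text \<open>Product rule for the constant FG; \<open>0 < T\<close> makes derivatives within the
  closed interval unique, also at its ends.\<close>

lemma product_const_deriv:
  fixes F :: "real \<Rightarrow> complex^'p^'r" and G :: "real \<Rightarrow> complex^'r^'p"
  assumes T: "0 < T" and x: "x \<in> {0..T}"
    and F: "(F has_vector_derivative F') (at x within {0..T})"
    and G: "(G has_vector_derivative G') (at x within {0..T})"
    and FG: "\<And>x. x \<in> {0..T} \<Longrightarrow> F x ** G x = mat 1"
  shows "F x ** G' + F' ** G x = 0"
proof -
  have "((\<lambda>x. F x ** G x) has_vector_derivative 0) (at x within {0..T})"
    by (rule has_vector_derivative_transform[OF x FG has_vector_derivative_const])
  then show ?thesis
    using vector_derivative_unique_within_closed_interval[of 0 T x "\<lambda>x. F x ** G x"]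
      has_vector_derivative_matrix_mult[OF F G] T x by simp
qed

text \<open>For fixed t put u = \<open>\<rho> x ** U x\<close> and w =
  \<open>\<sigma> x ** W x\<close>. These solve the system of the overview with zu replaced by
  \<open>\<rho> x ** k x t\<close>. Hence Gu + w has derivative G\<rho>k, while Fw stays 0, so that
  F(Gu + w) = u by FG = I. This is the equality of the kernels of KE and EA.\<close>

lemma intertwining_kernel_identity:
  fixes F F' :: "real \<Rightarrow> complex^'p^'r" and G G' :: "real \<Rightarrow> complex^'r^'p"
    and \<sigma> :: "real \<Rightarrow> complex^'p^'p" and \<rho> :: "real \<Rightarrow> complex^'r^'r"
  assumes T: "0 < T"
    and F: "\<And>x. x \<in> {0..T} \<Longrightarrow> (F has_vector_derivative F' x) (at x within {0..T})"
    and G: "\<And>x. x \<in> {0..T} \<Longrightarrow> (G has_vector_derivative G' x) (at x within {0..T})"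
    and FG: "\<And>x. x \<in> {0..T} \<Longrightarrow> F x ** G x = mat 1"
    and \<rho>: "\<And>x. x \<in> {0..T} \<Longrightarrow> (\<rho> has_vector_derivative F' x ** G x ** \<rho> x) (at x within {0..T})"
    and \<sigma>: "\<And>x. x \<in> {0..T} \<Longrightarrow> (\<sigma> has_vector_derivative - (G x ** F' x) ** \<sigma> x) (at x within {0..T})"
    and b: "continuous_on {0..T} b" "\<And>x. x \<in> {0..T} \<Longrightarrow> \<rho> x ** b x = F' x ** \<sigma> x"
    and c: "continuous_on {0..T} c" "\<And>x. x \<in> {0..T} \<Longrightarrow> \<sigma> x ** c x = - (G' x + G x ** F' x ** G x) ** \<rho> x"
    and k: "continuous_on (triangle T) (\<lambda>(x, t). k x t)" and q: "continuous_on (triangle T) (\<lambda>(x, t). q x t)"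
    and k_eq: "\<And>x t. (x, t) \<in> triangle T \<Longrightarrow> k x t = integral {x - t..x} (\<lambda>s. b s ** q s (s - (x - t)))"
    and q_eq: "\<And>x t. (x, t) \<in> triangle T \<Longrightarrow> q x t = c t + integral {t..x} (\<lambda>s. c s ** k s t)"
    and xt: "(x, t) \<in> triangle T"
  shows "F x ** (G t ** \<rho> t + integral {t..x} (\<lambda>s. G s ** (\<rho> s ** k s t))) =
    \<rho> x + integral {t..x} (\<lambda>s. \<rho> x ** k x s)"
proof -
  have t: "0 \<le> t" "t \<le> x" "x \<le> T" using xt by (auto simp: triangle_def)
  have sub: "{t..T} \<subseteq> {0..T}" using t by auto
  define U where "U x = mat 1 + integral {t..x} (k x)" for x
  define W where "W x = integral {t..x} (q x)" for x
  \<comment> \<open>\<open>V\<close> is $v = Gu + w$; its derivative is the integrand on the left-hand side.\<close>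
  define V where "V x = G x ** (\<rho> x ** U x) + \<sigma> x ** W x" for x
  note kd = transformation_kernel_derivatives[OF b(1) c(1) k q k_eq q_eq t(1)]
  have U: "(U has_vector_derivative b y ** W y + k y t) (at y within {t..T})"
    and W: "(W has_vector_derivative c y ** U y) (at y within {t..T})" if "y \<in> {t..T}" for y
    using kd[OF _ _ that] unfolding U_def[abs_def] W_def[abs_def] by blast+
  note wsub = has_vector_derivative_within_subset[OF _ sub]
  \<comment> \<open>Stated with an arbitrary right factor, so that they rewrite inside products
    associated to the right.\<close>
  have \<sigma>c: "\<sigma> y ** (c y ** A) = - (G' y ** (\<rho> y ** A)) - G y ** (F' y ** (G y ** (\<rho> y ** A)))"
    and \<rho>b: "\<rho> y ** (b y ** B) = F' y ** (\<sigma> y ** B)" if "y \<in> {0..T}" for y and A :: "complex^'r^'r" and B :: "complex^'r^'p"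
    using c(2)[OF that] b(2)[OF that]
    by (simp_all add: matrix_mul_assoc) (simp add: matrix_bilinear_simps matrix_mul_assoc)
  \<comment> \<open>Everything except the term with \<open>k\<close> cancels: G'u and GF'(Gu + w)
    occur in (Gu)' and, with opposite sign, in w'.\<close>
  have V': "(V has_vector_derivative G y ** (\<rho> y ** k y t)) (at y within {t..T})" if y: "y \<in> {t..T}" for y
  proof -
    have y0: "y \<in> {0..T}" using y t by auto
    have "(V has_vector_derivative
        G y ** (\<rho> y ** (b y ** W y + k y t) + F' y ** G y ** \<rho> y ** U y) + G' y ** (\<rho> y ** U y) +
        (\<sigma> y ** (c y ** U y) + - (G y ** F' y) ** \<sigma> y ** W y)) (at y within {t..T})"
      unfolding V_def[abs_def]
      by (intro has_vector_derivative_add has_vector_derivative_matrix_mult wsub F G \<rho> \<sigma> U W y y0)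
    then show ?thesis
      by (simp add: matrix_bilinear_simps \<sigma>c[OF y0] \<rho>b[OF y0] matrix_mul_assoc[symmetric])
  qed
  \<comment> \<open>Conservation of Fw: FG' = -F'G and FG = I cancel the terms in u and those in w
    separately.\<close>
  have Z': "((\<lambda>y. F y ** (\<sigma> y ** W y)) has_vector_derivative 0) (at y within {t..T})" if y: "y \<in> {t..T}" for y
  proof -
    have y0: "y \<in> {0..T}" using y t by auto
    have 0: "F y ** (G' y ** A) = - (F' y ** (G y ** A))" for A :: "complex^'r^'r"
      using product_const_deriv[OF T y0 F[OF y0] G[OF y0] FG]
      by (simp add: matrix_mul_assoc add_eq_0_iff2 matrix_bilinear_simps)
    have 1: "F y ** (G y ** A) = A" for A :: "complex^'r^'r"
      using FG[OF y0] by (simp add: matrix_mul_assoc)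
    have "((\<lambda>y. F y ** (\<sigma> y ** W y)) has_vector_derivative
        F y ** (\<sigma> y ** (c y ** U y) + - (G y ** F' y) ** \<sigma> y ** W y) + F' y ** (\<sigma> y ** W y)) (at y within {t..T})"
      by (intro has_vector_derivative_matrix_mult wsub F \<sigma> W y y0)
    then show ?thesis
      by (simp add: matrix_bilinear_simps \<sigma>c[OF y0] matrix_mul_assoc[symmetric] 0 1)
  qed
  have start: "U t = mat 1" "W t = 0" by (simp_all add: U_def W_def)
  obtain z where z: "\<And>y. y \<in> {t..T} \<Longrightarrow> F y ** (\<sigma> y ** W y) = z"
    using has_vector_derivative_zero_constant[OF _ Z'] by auto
  have FV: "F x ** (\<sigma> x ** W x) = 0"
    using z[of x] z[of t] t by (simp add: start)
  have "((\<lambda>s. G s ** (\<rho> s ** k s t)) has_integral V x - V t) {t..x}"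
    by (rule fundamental_theorem_of_calculus[OF t(2)], rule has_vector_derivative_within_subset[OF V'])
      (use t in auto)
  then have "V x = G t ** \<rho> t + integral {t..x} (\<lambda>s. G s ** (\<rho> s ** k s t))"
    by (simp add: integral_unique V_def start)
  then have "F x ** (G t ** \<rho> t + integral {t..x} (\<lambda>s. G s ** (\<rho> s ** k s t))) = F x ** V x"
    by simp
  also have "\<dots> = F x ** G x ** (\<rho> x ** U x) + F x ** (\<sigma> x ** W x)"
    by (simp add: V_def matrix_bilinear_simps matrix_mul_assoc)
  also have "\<dots> = F x ** G x ** (\<rho> x ** U x)" by (simp add: FV)
  also have "\<dots> = \<rho> x ** U x" using FG[of x] t by simp
  also have "\<dots> = \<rho> x + \<rho> x ** integral {t..x} (k x)"
    by (simp add: U_def matrix_bilinear_simps)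
  also have "\<rho> x ** integral {t..x} (k x) = integral {t..x} (\<lambda>s. \<rho> x ** k x s)"
    by (rule integral_matrix_mult_left[symmetric])
      (intro continuous_on_triangle_compose[OF k] continuous_intros; use t in auto)
  finally show ?thesis .
qed

section \<open>Similarity\<close>

text \<open>\<open>F x\<close> is constant in t and passes under the integral once G f is known to
  be integrable on the segment.\<close>

lemma K_op_eq_triangular:
  fixes F :: "real \<Rightarrow> complex^'p^'r" and G :: "real \<Rightarrow> complex^'r^'p"
  assumes G: "continuous_on {0..T} G" and f: "f \<in> L2 T" and x: "x \<in> {0<..<T}"
  shows "K_op F G f x = triangular_op (\<lambda>_. 0) (\<lambda>x t. F x ** G t) f x"
proof -
  have "continuous_on (triangle T) (\<lambda>(s, t). G t)"
    unfolding case_prod_unfold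
    by (intro continuous_on_compose2[OF G] continuous_intros) (auto simp: triangle_def)
  from integrable_tri_ext[OF this L2_D(3)[OF f], of x]
  have i: "integrable (lebesgue_on {0<..<T}) (\<lambda>t. indicator {..x} t *\<^sub>R (G t *v f t))"
    by (rule Bochner_Integration.integrable_cong[THEN iffD1, OF refl, rotated])
      (use x in \<open>auto simp: tri_ext_def triangle_def indicator_def\<close>)
  have bl: "bounded_linear (\<lambda>v. F x *v v)"
    by (rule bounded_bilinear.bounded_linear_right[OF bounded_bilinear_matrix_vector_mult])
  have eq: "F x *v (indicator {..x} t *\<^sub>R (G t *v f t)) = indicator {..x} t *\<^sub>R ((F x ** G t) *v f t)" for t
    by (auto simp: indicator_def matrix_vector_mul_assoc)
  have m: "(\<lambda>t. indicator {..x} t *\<^sub>R ((F x ** G t) *v f t)) \<in> borel_measurable (lebesgue_on {0<..<T})"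
    using borel_measurable_integrable[OF integrable_bounded_linear[OF bl i]] unfolding eq .
  show ?thesis
    using integral_bounded_linear[OF bl i] x
    by (simp add: K_op_def triangular_op_def LINT_initial_segment[OF _ _ borel_measurable_integrable[OF i]]
        LINT_initial_segment[OF _ _ m] eq)
qed

lemma integration_op_eq_triangular:
  "integration_op = triangular_op (\<lambda>_. 0) (\<lambda>_ _. mat 1)"
  by (intro ext) (simp add: integration_op_def triangular_op_def)

lemma L2_add:
  assumes f: "f \<in> L2 T" and g: "g \<in> L2 T"
  shows "(\<lambda>x. f x + g x) \<in> L2 T"
proof -
  note [measurable] = L2_D(1)[OF f] L2_D(1)[OF g]
  have "integrable (lebesgue_on {0<..<T}) (\<lambda>x. (norm (f x + g x))\<^sup>2)"
  proof (rule Bochner_Integration.integrable_bound)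
    show "integrable (lebesgue_on {0<..<T}) (\<lambda>x. 2 * (norm (f x))\<^sup>2 + 2 * (norm (g x))\<^sup>2)"
      using L2_D(2)[OF f] L2_D(2)[OF g] by simp
    have "(norm (f x + g x))\<^sup>2 \<le> 2 * (norm (f x))\<^sup>2 + 2 * (norm (g x))\<^sup>2" for x
    proof -
      have "(norm (f x + g x))\<^sup>2 \<le> (norm (f x) + norm (g x))\<^sup>2"
        by (intro power_mono norm_triangle_ineq norm_ge_zero)
      then show ?thesis
        using zero_le_power2[of "norm (f x) - norm (g x)"] by (simp add: power2_sum power2_diff)
    qed
    then show "AE x in lebesgue_on {0<..<T}. norm ((norm (f x + g x))\<^sup>2) \<le> norm (2 * (norm (f x))\<^sup>2 + 2 * (norm (g x))\<^sup>2)"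
      by (intro AE_I2) auto
  qed measurable
  then show ?thesis by (simp add: L2_def)
qed

lemma L2_scale:
  assumes f: "f \<in> L2 T"
  shows "(\<lambda>x. c *s f x) \<in> L2 T"
proof -
  have n: "norm (c *s v) = cmod c * norm v" for v :: "complex^'r"
    by (simp add: norm_vec_def norm_mult L2_set_right_distrib)
  have bl: "bounded_linear (\<lambda>v::complex^'r. c *s v)"
    unfolding linear_conv_bounded_linear[symmetric]
    by (auto intro!: linearI simp: vec_eq_iff distrib_left)
  show ?thesis
    using L2_D(2)[OF f] borel_measurable_integrable[OF integrable_bounded_linear[OF bl L2_D(3)[OF f]]]
    by (simp add: L2_def n power_mult_distrib)
qed

text \<open>\<open>K_op\<close> is shown to agree with a triangular operator only on L2 functions
  and inside (0,T), so boundedness has to be transferred through this restricted equality.\<close>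

lemma bounded_op_cong:
  assumes S: "bounded_op T S"
    and eq: "\<And>f x. \<lbrakk>f \<in> L2 T; x \<in> {0<..<T}\<rbrakk> \<Longrightarrow> R f x = S f x"
  shows "bounded_op T R"
proof -
  have ae: "ae_eq T (R f) (S f)" if "f \<in> L2 T" for f
    by (intro ae_eqI eq that)
  have L2: "R f \<in> L2 T" if f: "f \<in> L2 T" for f
  proof -
    note SL = bounded_opD(1)[OF S f]
    have "R f \<in> borel_measurable (lebesgue_on {0<..<T})"
      by (rule measurable_cong[THEN iffD1, OF _ L2_D(1)[OF SL]]) (simp add: eq f)
    moreover have "integrable (lebesgue_on {0<..<T}) (\<lambda>x. (norm (R f x))\<^sup>2)"
      by (rule Bochner_Integration.integrable_cong[THEN iffD1, OF refl _ L2_D(2)[OF SL]]) (simp add: eq f)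
    ultimately show ?thesis by (simp add: L2_def)
  qed
  have nrm: "norm_L2 T (R f) = norm_L2 T (S f)" if "f \<in> L2 T" for f
    unfolding norm_L2_def
    by (intro arg_cong[where f = sqrt] Bochner_Integration.integral_cong refl) (simp add: eq that)
  have cong: "ae_eq T (R f) (R g)" if "f \<in> L2 T" "g \<in> L2 T" "ae_eq T f g" for f g
    using ae_eq_trans[OF ae[OF that(1)] ae_eq_trans[OF bounded_opD(2)[OF S that] ae_eq_sym[OF ae[OF that(2)]]]] .
  have add: "ae_eq T (R (\<lambda>x. f x + g x)) (\<lambda>x. R f x + R g x)" if "f \<in> L2 T" "g \<in> L2 T" for f g
  proof -
    have "ae_eq T (R (\<lambda>x. f x + g x)) (S (\<lambda>x. f x + g x))" by (intro ae L2_add that)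
    also have "ae_eq T \<dots> (\<lambda>x. S f x + S g x)" by (rule bounded_opD(3)[OF S that])
    also have "ae_eq T \<dots> (\<lambda>x. R f x + R g x)" by (intro ae_eqI) (simp add: eq that)
    finally show ?thesis .
  qed
  have scale: "ae_eq T (R (\<lambda>x. c *s f x)) (\<lambda>x. c *s R f x)" if f: "f \<in> L2 T" for c f
  proof -
    have "ae_eq T (R (\<lambda>x. c *s f x)) (S (\<lambda>x. c *s f x))" by (intro ae L2_scale f)
    also have "ae_eq T \<dots> (\<lambda>x. c *s S f x)" using S f by (simp add: bounded_op_def)
    also have "ae_eq T \<dots> (\<lambda>x. c *s R f x)" by (intro ae_eqI) (simp add: eq f)
    finally show ?thesis .
  qed
  obtain C where "\<And>f. f \<in> L2 T \<Longrightarrow> norm_L2 T (S f) \<le> C * norm_L2 T f"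
    using S unfolding bounded_op_def by blast
  then have "\<forall>f\<in>L2 T. norm_L2 T (R f) \<le> C * norm_L2 T f" by (simp add: nrm)
  then show ?thesis
    unfolding bounded_op_def using L2 cong add scale by blast
qed

text \<open>FG = I turns the term F G h of the derivative into h. Hence K maps continuous functions
  to C1 functions, and differentiating an equation F(v + integral of G h) = f gives a Volterra
  equation of the second kind for h.\<close>

lemma K_op_primitive_deriv:
  fixes F F' :: "real \<Rightarrow> complex^'p^'r" and G :: "real \<Rightarrow> complex^'r^'p"
  assumes F: "\<And>x. x \<in> {0..T} \<Longrightarrow> (F has_vector_derivative F' x) (at x within {0..T})"
    and G: "continuous_on {0..T} G" and FG: "\<And>x. x \<in> {0..T} \<Longrightarrow> F x ** G x = mat 1"
    and h: "continuous_on {0..T} h" and x: "x \<in> {0..T}"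
  shows "((\<lambda>x. F x *v (v + integral {0..x} (\<lambda>t. G t *v h t))) has_vector_derivative
    h x + F' x *v (v + integral {0..x} (\<lambda>t. G t *v h t))) (at x within {0..T})"
proof -
  have "((\<lambda>x. F x *v (v + integral {0..x} (\<lambda>t. G t *v h t))) has_vector_derivative
    F x *v (0 + G x *v h x) + F' x *v (v + integral {0..x} (\<lambda>t. G t *v h t))) (at x within {0..T})"
    by (intro has_vector_derivative_matrix_vector_mult has_vector_derivative_add has_vector_derivative_const
        integral_has_vector_derivative continuous_intros F G h x)
  then show ?thesis using FG[OF x] by (simp add: matrix_vector_mul_assoc)
qed

lemma K_op_continuous:
  assumes "continuous_on {0..T} G" "continuous_on {0..T} h" "x \<in> {0..T}"
  shows "K_op F G h x = F x *v integral {0..x} (\<lambda>t. G t *v h t)"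
  unfolding K_op_def
  by (subst LINT_eq_integral)
    (use assms in \<open>auto intro!: continuous_on_matrix_vector_mult intro: continuous_on_subset\<close>)

lemma integration_op_continuous:
  fixes h :: "real \<Rightarrow> complex^'r"
  assumes "continuous_on {0..T} h" "x \<in> {0..T}"
  shows "integration_op h x = integral {0..x} h"
  unfolding integration_op_def
  by (subst LINT_eq_integral) (use assms in \<open>auto intro: continuous_on_subset\<close>)

theorem proposition4p1:
  fixes T :: real
    and F :: "real \<Rightarrow> complex^'p^'r"
    and G :: "real \<Rightarrow> complex^'r^'p"
  assumes "T > 0"
    and "C1_on_interval T F"
    and "C1_on_interval T G"
    and "\<And>x. 0 \<le> x \<Longrightarrow> x \<le> T \<Longrightarrow> F x ** G x = mat 1"
  shows "similar_op T (K_op F G) integration_op \<and>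
    (\<exists>(\<rho> :: real \<Rightarrow> complex^'r^'r) (e :: real \<Rightarrow> real \<Rightarrow> complex^'r^'r) Einv.
       (\<forall>x\<in>{0..T}. (\<rho> has_vector_derivative
            (vector_derivative F (at x within {0..T}) ** G x ** \<rho> x)) (at x within {0..T})) \<and>
       \<rho> 0 = mat 1 \<and>
       continuous_on {(x, t). 0 \<le> t \<and> t \<le> x \<and> x \<le> T} (\<lambda>(x, t). e x t) \<and>
       (\<forall>x\<in>{0..T}. e x 0 = 0) \<and>
       inverse_ops T (triangular_op \<rho> e) Einv \<and>
       (\<forall>f\<in>L2 T. ae_eq T (K_op F G f) (triangular_op \<rho> e (integration_op (Einv f)))) \<and>
       preserves_C1 T (triangular_op \<rho> e) \<and>
       preserves_C1 T Einv)"
proof -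
  note T = assms(1)
  have FG: "F x ** G x = mat 1" if "x \<in> {0..T}" for x
    using assms(4) that by simp
  obtain F' where F: "\<And>x. x \<in> {0..T} \<Longrightarrow> (F has_vector_derivative F' x) (at x within {0..T})"
    and F'_cont: "continuous_on {0..T} F'"
    using assms(2) unfolding C1_on_interval_def by blast
  obtain G' where G: "\<And>x. x \<in> {0..T} \<Longrightarrow> (G has_vector_derivative G' x) (at x within {0..T})"
    and G'_cont: "continuous_on {0..T} G'"
    using assms(3) unfolding C1_on_interval_def by blast
  have F_cont: "continuous_on {0..T} F" and G_cont: "continuous_on {0..T} G"
    using has_vector_derivative_imp_continuous_on[OF F] has_vector_derivative_imp_continuous_on[OF G] by auto

  have F'G: "continuous_on {0..T} (\<lambda>x. F' x ** G x)" by (intro continuous_intros F'_cont G_cont)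
  obtain \<rho> \<tau> where \<rho>: "\<And>x. x \<in> {0..T} \<Longrightarrow> (\<rho> has_vector_derivative F' x ** G x ** \<rho> x) (at x within {0..T})"
    and \<rho>0: "\<rho> 0 = mat 1"
    and \<tau>_cont: "continuous_on {0..T} \<tau>" and \<rho>\<tau>: "\<And>x. x \<in> {0..T} \<Longrightarrow> \<rho> x ** \<tau> x = mat 1"
    using fundamental_matrix[OF F'G] by metis
  have GF': "continuous_on {0..T} (\<lambda>x. - (G x ** F' x))" by (intro continuous_intros F'_cont G_cont)
  obtain \<sigma> \<upsilon> :: "real \<Rightarrow> complex^'p^'p" where \<sigma>: "\<And>x. x \<in> {0..T} \<Longrightarrow> (\<sigma> has_vector_derivative - (G x ** F' x) ** \<sigma> x) (at x within {0..T})"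
    and \<upsilon>_cont: "continuous_on {0..T} \<upsilon>" and \<sigma>\<upsilon>: "\<And>x. x \<in> {0..T} \<Longrightarrow> \<sigma> x ** \<upsilon> x = mat 1"
    using fundamental_matrix[OF GF'] by metis
  have \<rho>_cont: "continuous_on {0..T} \<rho>" and \<sigma>_cont: "continuous_on {0..T} \<sigma>"
    using has_vector_derivative_imp_continuous_on[OF \<rho>] has_vector_derivative_imp_continuous_on[OF \<sigma>] by auto
  \<comment> \<open>The coefficients of the transformed system: \<rho>^{-1} F' \<sigma> for b and
    -\<sigma>^{-1} (G' + GF'G) \<rho> for c, with \<tau> and \<upsilon> as the inverses.\<close>
  define b where "b x = \<tau> x ** (F' x ** \<sigma> x)" for x
  define c where "c x = \<upsilon> x ** (- (G' x + G x ** F' x ** G x) ** \<rho> x)" for x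
  have b_cont: "continuous_on {0..T} b" and c_cont: "continuous_on {0..T} c"
    unfolding b_def c_def
    by (intro continuous_intros F'_cont G_cont G'_cont \<rho>_cont \<sigma>_cont \<tau>_cont \<upsilon>_cont)+
  have \<rho>b: "\<rho> x ** b x = F' x ** \<sigma> x" and \<sigma>c: "\<sigma> x ** c x = - (G' x + G x ** F' x ** G x) ** \<rho> x"
    if "x \<in> {0..T}" for x
    unfolding b_def c_def matrix_mul_assoc[of "\<rho> x"] matrix_mul_assoc[of "\<sigma> x"] \<rho>\<tau>[OF that] \<sigma>\<upsilon>[OF that] by simp_all
  obtain k q where k: "continuous_on (triangle T) (\<lambda>(x, t). k x t)" and q: "continuous_on (triangle T) (\<lambda>(x, t). q x t)"
    and k_eq: "\<And>x t. (x, t) \<in> triangle T \<Longrightarrow> k x t = integral {x - t..x} (\<lambda>s. b s ** q s (s - (x - t)))"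
    and q_eq: "\<And>x t. (x, t) \<in> triangle T \<Longrightarrow> q x t = c t + integral {t..x} (\<lambda>s. c s ** k s t)"
    using transformation_kernels[OF b_cont c_cont] by blast
  define e where "e x t = \<rho> x ** k x t" for x t
  have e: "continuous_on (triangle T) (\<lambda>(x, t). e x t)"
    using k unfolding e_def case_prod_unfold
    by (intro continuous_intros continuous_on_compose2[OF \<rho>_cont]) (auto simp: triangle_def)
  \<comment> \<open>At t = 0 the integral giving \<open>k\<close> runs over
    \<open>{x..x}\<close>.\<close>
  have e0: "e x 0 = 0" if "x \<in> {0..T}" for x
    using k_eq[of x 0] that by (simp add: e_def triangle_def)
  have kernel_id: "F x ** (G t ** \<rho> t + integral {t..x} (\<lambda>s. G s ** e s t)) = \<rho> x + integral {t..x} (e x)"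
    if "(x, t) \<in> triangle T" for x t
    using intertwining_kernel_identity[OF T F G FG \<rho> \<sigma> b_cont \<rho>b c_cont \<sigma>c k q k_eq q_eq that]
    by (simp add: e_def[abs_def])

  let ?E = "triangular_op \<rho> e" and ?K = "K_op F G"
  let ?\<kappa> = "\<lambda>x t. F x ** G t"
  obtain e' where e': "continuous_on (triangle T) (\<lambda>(x, t). e' x t)"
    and inv: "inverse_ops T ?E (triangular_op \<tau> e')"
    by (rule triangular_op_inverse[OF T \<rho>_cont \<tau>_cont \<rho>\<tau> e])
  let ?R = "triangular_op \<tau> e'"
  have bE: "bounded_op T ?E" and bR: "bounded_op T ?R"
    and ER: "\<And>f. f \<in> L2 T \<Longrightarrow> ae_eq T (?E (?R f)) f" and RE: "\<And>f. f \<in> L2 T \<Longrightarrow> ae_eq T (?R (?E f)) f"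
    using inv by (auto simp: inverse_ops_def)
  have zero_cont: "continuous_on {0..T} (\<lambda>_. 0 :: complex^'r^'r)" by simp
  have \<kappa>: "continuous_on (triangle T) (\<lambda>(x, t). ?\<kappa> x t)"
    unfolding case_prod_unfold
    by (intro continuous_intros continuous_on_compose2[OF F_cont] continuous_on_compose2[OF G_cont])
      (auto simp: triangle_def)
  have one: "continuous_on (triangle T) (\<lambda>(x, t). mat 1 :: complex^'r^'r)" by (simp add: case_prod_unfold)
  have bK: "bounded_op T ?K"
    by (rule bounded_op_cong[OF bounded_op_triangular[OF T zero_cont \<kappa>] K_op_eq_triangular[OF G_cont]])
  have bA: "bounded_op T (integration_op :: (real \<Rightarrow> complex^'r) \<Rightarrow> _)"
    unfolding integration_op_eq_triangular by (rule bounded_op_triangular[OF T zero_cont one])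

  \<comment> \<open>Both products are triangular with multiplication part 0, so the claim reduces to
    equality of the kernels, which is \<open>kernel_id\<close>.\<close>
  have KE: "?K (?E f) x = ?E (integration_op f) x" if f: "f \<in> L2 T" and x: "x \<in> {0<..<T}" for f x
  proof -
    have "?K (?E f) x = triangular_op (\<lambda>x. 0 ** \<rho> x) (comp_kernel (\<lambda>_. 0) ?\<kappa> \<rho> e) f x"
      unfolding K_op_eq_triangular[OF G_cont bounded_opD(1)[OF bE f] x]
      by (rule triangular_op_comp[OF T zero_cont \<kappa> \<rho>_cont e f x])
    also have "\<dots> = triangular_op (\<lambda>x. \<rho> x ** 0) (comp_kernel \<rho> e (\<lambda>_. 0) (\<lambda>_ _. mat 1)) f x"
    proof (rule triangular_op_cong[of _ T])
      fix t assume t: "0 \<le> t" "t \<le> x"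
      have "continuous_on {t..x} (\<lambda>s. G s ** e s t)"
        by (intro continuous_intros continuous_on_compose2[OF G_cont] continuous_on_triangle_compose[OF e])
          (use t x in auto)
      from integral_matrix_mult_left[OF this, of "F x"]
      show "comp_kernel (\<lambda>_. 0) ?\<kappa> \<rho> e x t = comp_kernel \<rho> e (\<lambda>_. 0) (\<lambda>_ _. mat 1) x t"
        using kernel_id[of x t] t x
        by (simp add: comp_kernel_def triangle_def matrix_bilinear_simps matrix_mul_assoc)
    qed (use x in simp_all)
    also have "\<dots> = ?E (integration_op f) x"
      unfolding integration_op_eq_triangular
      by (rule triangular_op_comp[OF T \<rho>_cont e zero_cont one f x, symmetric])
    finally show ?thesis .
  qed

  have similarity: "ae_eq T (?K f) (?E (integration_op (?R f)))" if f: "f \<in> L2 T" for f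
  proof -
    note Rf = bounded_opD(1)[OF bR f]
    have "ae_eq T (?K f) (?K (?E (?R f)))"
      by (intro bounded_opD(2)[OF bK f] bounded_opD(1)[OF bE] Rf ae_eq_sym[OF ER] f)
    also have "ae_eq T \<dots> (?E (integration_op (?R f)))"
      by (intro ae_eqI KE Rf)
    finally show ?thesis .
  qed

  text \<open>The normalisation \<open>e x 0 = 0\<close> gives $E 1 = F(\cdot) G(0)$.\<close>
  have E_const: "?E (\<lambda>_. v) x = F x *v (G 0 *v v)" if x: "x \<in> {0..T}" for v x
  proof -
    have "continuous_on {0..x} (e x)"
      by (intro continuous_on_triangle_compose[OF e] continuous_intros) (use x in auto)
    then have "integral {0..x} (\<lambda>t. e x t *v v) = integral {0..x} (e x) *v v"
      using integral_linear[OF integrable_continuous_interval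
          bounded_bilinear.bounded_linear_left[OF bounded_bilinear_matrix_vector_mult, of v]]
      by (simp add: o_def)
    then have "?E (\<lambda>_. v) x = (\<rho> x + integral {0..x} (e x)) *v v"
      using triangular_op_continuous[OF e _ x, of "\<lambda>_. v" \<rho>] by (simp add: matrix_vector_mult_add_rdistrib)
    \<comment> \<open>Since e(s,0) = 0 and \<rho>(0) = I, the kernel identity at t = 0 loses its
      integral on the left and leaves F(x)G(0).\<close>
    also have "integral {0..x} (\<lambda>s. G s ** e s 0) = integral {0..x} (\<lambda>s. 0)"
      by (rule integral_cong) (use x e0 in auto)
    then have "\<rho> x + integral {0..x} (e x) = F x ** G 0"
      using kernel_id[of x 0] x by (simp add: triangle_def \<rho>0)
    finally show ?thesis by (simp add: matrix_vector_mul_assoc)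
  qed

  \<comment> \<open>A C1 function is a constant plus A of a continuous function, so this one formula
    serves for E and for its inverse.\<close>
  have E_affine: "ae_eq T (?E (\<lambda>x. v + integration_op h x)) (\<lambda>x. F x *v (G 0 *v v) + ?K (?E h) x)"
    if h: "h \<in> L2 T" for v h
  proof -
    have v: "(\<lambda>_. v) \<in> L2 T" by (intro continuous_imp_L2) simp
    have "ae_eq T (?E (\<lambda>x. v + integration_op h x)) (\<lambda>x. ?E (\<lambda>_. v) x + ?E (integration_op h) x)"
      by (rule bounded_opD(3)[OF bE v bounded_opD(1)[OF bA h]])
    also have "ae_eq T \<dots> (\<lambda>x. F x *v (G 0 *v v) + ?K (?E h) x)"
      by (intro ae_eqI) (simp add: E_const KE h)
    finally show ?thesis .
  qed

  have E_C1: "preserves_C1 T ?E"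
    unfolding preserves_C1_def
  proof (intro allI impI)
    fix f :: "real \<Rightarrow> complex^'r" assume "C1_on_interval T f"
    then obtain f' where f: "\<And>x. x \<in> {0..T} \<Longrightarrow> (f has_vector_derivative f' x) (at x within {0..T})"
      and f': "continuous_on {0..T} f'" unfolding C1_on_interval_def by blast
    have f_eq: "f x = f 0 + integration_op f' x" if x: "x \<in> {0..T}" for x
    proof -
      have "(f' has_integral f x - f 0) {0..x}"
        by (rule fundamental_theorem_of_calculus, use x in simp,
            rule has_vector_derivative_within_subset[OF f]) (use x in auto)
      then show ?thesis by (simp add: integration_op_continuous[OF f' x] integral_unique)
    qed
    have h: "continuous_on {0..T} (?E f')" by (rule continuous_on_triangular_op[OF \<rho>_cont e f'])
    define g where "g x = F x *v (G 0 *v f 0 + integral {0..x} (\<lambda>t. G t *v ?E f' t))" for x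
    have "C1_on_interval T g"
      unfolding C1_on_interval_def g_def
      by (intro exI[of _ "\<lambda>x. ?E f' x + F' x *v (G 0 *v f 0 + integral {0..x} (\<lambda>t. G t *v ?E f' t))"] conjI ballI
          K_op_primitive_deriv[OF F G_cont FG h] continuous_intros h F'_cont indefinite_integral_continuous_1
          integrable_continuous_interval G_cont)
    moreover have "ae_eq T (?E f) (?E (\<lambda>x. f 0 + integration_op f' x))"
      by (intro ae_eqI triangular_op_cong[of _ T] f_eq) auto
    then have "ae_eq T (?E f) (\<lambda>x. F x *v (G 0 *v f 0) + ?K (?E f') x)"
      by (rule ae_eq_trans[OF _ E_affine[OF continuous_imp_L2[OF f']]])
    then have "ae_eq T (?E f) g"
      by (rule ae_eq_trans) (intro ae_eqI; simp add: g_def K_op_continuous[OF G_cont h] matrix_vector_right_distrib)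
    ultimately show "\<exists>g. C1_on_interval T g \<and> ae_eq T (?E f) g" by blast
  qed

  have R_C1: "preserves_C1 T ?R"
    unfolding preserves_C1_def
  proof (intro allI impI)
    fix f :: "real \<Rightarrow> complex^'r" assume "C1_on_interval T f"
    then obtain f' where f: "\<And>x. x \<in> {0..T} \<Longrightarrow> (f has_vector_derivative f' x) (at x within {0..T})"
      and f': "continuous_on {0..T} f'" unfolding C1_on_interval_def by blast
    have fL: "f \<in> L2 T"
      by (intro continuous_imp_L2 has_vector_derivative_imp_continuous_on[OF f])
    obtain C\<^sub>1 where C1: "0 \<le> C\<^sub>1" "\<And>x. x \<in> {0..T} \<Longrightarrow> norm (F' x) \<le> C\<^sub>1"
      using bounded_on_interval[OF F'_cont] by metis
    obtain C\<^sub>2 where C2: "0 \<le> C\<^sub>2" "\<And>x. x \<in> {0..T} \<Longrightarrow> norm (G x) \<le> C\<^sub>2"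
      using bounded_on_interval[OF G_cont] by metis
    obtain L\<^sub>1 where L1: "0 \<le> L\<^sub>1" "\<And>(A::complex^'p^'r) v. norm (A *v v) \<le> norm A * norm v * L\<^sub>1"
      using bounded_bilinear.nonneg_bounded[OF bounded_bilinear_matrix_vector_mult] by metis
    obtain L\<^sub>2 where L2: "0 \<le> L\<^sub>2" "\<And>(A::complex^'r^'p) v. norm (A *v v) \<le> norm A * norm v * L\<^sub>2"
      using bounded_bilinear.nonneg_bounded[OF bounded_bilinear_matrix_vector_mult] by metis
    \<comment> \<open>A common Lipschitz constant for the maps outside and inside the integral in
      \<open>volterra_equation\<close>.\<close>
    define B where "B = C\<^sub>1 * L\<^sub>1 + C\<^sub>2 * L\<^sub>2"
    have "0 \<le> C\<^sub>1 * L\<^sub>1" "0 \<le> C\<^sub>2 * L\<^sub>2" using C1 C2 L1 L2 by simp_all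
    then have B: "0 \<le> B" "C\<^sub>1 * L\<^sub>1 \<le> B" "C\<^sub>2 * L\<^sub>2 \<le> B" by (simp_all add: B_def)
    have lip1: "norm (- (F' s *v y) - - (F' s *v z)) \<le> B * norm (y - z)" if s: "s \<in> {0..T}" for s y z
    proof -
      have "norm (F' s *v (z - y)) \<le> C\<^sub>1 * norm (z - y) * L\<^sub>1"
        by (intro order_trans[OF L1(2)] mult_right_mono C1 L1 norm_ge_zero s)
      also have "\<dots> \<le> B * norm (z - y)"
        using mult_right_mono[OF B(2) norm_ge_zero[of "z - y"]] by (simp add: mult_ac)
      finally show ?thesis by (simp add: matrix_vector_mult_diff_distrib norm_minus_commute)
    qed
    have lip2: "norm (G s *v y - G s *v z) \<le> B * norm (y - z)" if s: "s \<in> {0..T}" for s y z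
    proof -
      have "norm (G s *v (y - z)) \<le> C\<^sub>2 * norm (y - z) * L\<^sub>2"
        by (intro order_trans[OF L2(2)] mult_right_mono C2 L2 norm_ge_zero s)
      also have "\<dots> \<le> B * norm (y - z)"
        using mult_right_mono[OF B(3) norm_ge_zero[of "y - z"]] by (simp add: mult_ac)
      finally show ?thesis by (simp add: matrix_vector_mult_diff_distrib)
    qed
    have a: "continuous_on {0..T} (\<lambda>x. f' x - F' x *v (G 0 *v f 0))"
      by (intro continuous_intros f' F'_cont)
    \<comment> \<open>Setting the derivative of F(G(0)f(0) + integral of G h) equal to f' gives this
      equation for \<open>h\<close>.\<close>
    obtain h where h: "continuous_on {0..T} h"
      and h_eq: "\<And>x. x \<in> {0..T} \<Longrightarrow> h x = f' x - F' x *v (G 0 *v f 0) + - (F' x *v integral {0..x} (\<lambda>s. G s *v h s))"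
      by (rule volterra_equation[OF a B(1), of "\<lambda>s y. - (F' s *v y)" "\<lambda>s y. G s *v y"])
        (use lip1 lip2 F'_cont G_cont in \<open>auto intro!: continuous_intros\<close>)
    define u where "u x = F x *v (G 0 *v f 0 + integral {0..x} (\<lambda>t. G t *v h t))" for x
    have u: "(u has_vector_derivative f' x) (at x within {0..T})" if x: "x \<in> {0..T}" for x
      using K_op_primitive_deriv[OF F G_cont FG h x, of "G 0 *v f 0"] h_eq[OF x]
      by (simp add: u_def[abs_def] matrix_vector_right_distrib)
    \<comment> \<open>Equal derivatives make f - u constant; the constant is 0 because F(0)G(0) = I
      gives u(0) = f(0).\<close>
    have "((\<lambda>x. f x - u x) has_vector_derivative 0) (at x within {0..T})" if "x \<in> {0..T}" for x
      using has_vector_derivative_diff[OF f[OF that] u[OF that]] by simp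
    then obtain d where d: "\<And>x. x \<in> {0..T} \<Longrightarrow> f x - u x = d"
      using has_vector_derivative_zero_constant[of "{0..T}" "\<lambda>x. f x - u x"] by auto
    have "u 0 = f 0" using FG[of 0] T by (simp add: u_def matrix_vector_mul_assoc)
    then have f_eq: "F x *v (G 0 *v f 0) + ?K h x = f x" if "x \<in> {0..T}" for x
      using d[OF that] d[of 0] T that
      by (simp add: u_def K_op_continuous[OF G_cont h] matrix_vector_right_distrib)

    \<comment> \<open>The candidate for E^{-1}f: by \<open>E_affine\<close> its image under E is F
      G(0) f(0) + K E E^{-1} h, which is f almost everywhere.\<close>
    define w where "w x = f 0 + integration_op (?R h) x" for x
    have hL: "h \<in> L2 T" by (rule continuous_imp_L2[OF h])
    have Rh: "continuous_on {0..T} (?R h)" by (rule continuous_on_triangular_op[OF \<tau>_cont e' h])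
    note RhL = bounded_opD(1)[OF bR hL]
    have w_eq: "f 0 + integral {0..x} (?R h) = w x" if "x \<in> {0..T}" for x
      by (simp add: w_def integration_op_continuous[OF Rh that])
    have w0: "((\<lambda>x. f 0 + integral {0..x} (?R h)) has_vector_derivative 0 + ?R h x) (at x within {0..T})"
      if "x \<in> {0..T}" for x
      by (intro has_vector_derivative_add has_vector_derivative_const integral_has_vector_derivative Rh that)
    have w: "(w has_vector_derivative ?R h x) (at x within {0..T})" if "x \<in> {0..T}" for x
      using w0[OF that] unfolding add_0_left
      by (rule has_vector_derivative_transform[OF that, rotated]) (simp only: w_eq)
    have wL: "w \<in> L2 T"
      by (intro continuous_imp_L2 has_vector_derivative_imp_continuous_on[OF w])
    have "ae_eq T (?E w) (\<lambda>x. F x *v (G 0 *v f 0) + ?K (?E (?R h)) x)"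
      unfolding w_def by (rule E_affine[OF RhL])
    moreover have "ae_eq T (?K (?E (?R h))) (?K h)"
      by (intro bounded_opD(2)[OF bK] bounded_opD(1)[OF bE] RhL hL ER)
    ultimately have "AE x in lebesgue_on {0<..<T}. x \<in> {0<..<T} \<longrightarrow> ?E w x = f x"
      unfolding ae_eq_def by eventually_elim (simp add: f_eq)
    then have Ew: "ae_eq T (?E w) f"
      unfolding ae_eq_def by (simp add: AE_restrict_space_iff)
    have "ae_eq T (?R f) (?R (?E w))"
      by (rule bounded_opD(2)[OF bR fL bounded_opD(1)[OF bE wL] ae_eq_sym[OF Ew]])
    also have "ae_eq T \<dots> w" by (rule RE[OF wL])
    finally have "ae_eq T (?R f) w" .
    moreover have "C1_on_interval T w"
      unfolding C1_on_interval_def using w Rh by blast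
    ultimately show "\<exists>g. C1_on_interval T g \<and> ae_eq T (?R f) g" by blast
  qed

  have "similar_op T ?K integration_op"
    unfolding similar_op_def using bK bA inv similarity by blast
  moreover have "(\<rho> has_vector_derivative vector_derivative F (at x within {0..T}) ** G x ** \<rho> x) (at x within {0..T})"
    if x: "x \<in> {0..T}" for x
    using \<rho>[OF x] vector_derivative_within_closed_interval[OF T x F[OF x]] by simp
  ultimately show ?thesis
    using \<rho>0 e[unfolded triangle_def] e0 inv similarity E_C1 R_C1 by blast
qed

end
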